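(* There is a constant $c>0$ such that for every sufficiently large integer $k$, with $n=12k+1$, there exists an AUSO of the graph of the dual cyclic $4$-polytope $C^{*}(n)$ on which the random facet pivot rule, started at the global source, takes at least $c\,n^2$ pivot steps.
   Context: $C^{*}(n)$ is a simple $4$-polytope combinatorially dual to the cyclic polytope $C(n)=\operatorname{conv}\{(t,t^2,t^3,t^4)^T: t=0,\dots,n-1\}$. An AUSO (acyclic unique sink orientation) of the graph of a polytope is an acyclic orientation of its vertex–edge graph such that every nonempty face induces a subgraph with a unique sink; the global source/sink is the unique source/sink of the whole polytope. A 1-vertex is a vertex with exactly one outgoing edge. Random facet pivot rule: at each non-optimal vertex $v$, if $v$ is a 1-vertex follow its unique outgoing edge; otherwise choose a facet $f$ containing $v$ uniformly at random, solve the problem restricted to $f$ (i.e. reach the sink of $f$) by applying random facet recursively within $f$, and continue from there. A pivot step is the traversal of one edge. *)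

theory Defs
  imports "HOL-Analysis.Analysis" "HOL-Probability.SPMF"
begin

section \<open>The dual cyclic 4-polytopes\<close>

definition moment_curve4 :: "real \<Rightarrow> real ^ 4" where
  "moment_curve4 t = vector [t, t ^ 2, t ^ 3, t ^ 4]"

definition cyclic_polytope4 :: "nat \<Rightarrow> (real ^ 4) set" where
  "cyclic_polytope4 n = convex hull ((\<lambda>i. moment_curve4 (real i)) ` {0..<n})"

text \<open>The relation \<^const>\<open>face_of\<close> counts the empty set and the polytope itself as faces, so the
  bijection below is between the full face lattices.\<close>

definition combinatorially_dual ::
  "'a::euclidean_space set \<Rightarrow> 'b::euclidean_space set \<Rightarrow> bool" where
  "combinatorially_dual P Q \<longleftrightarrow>
    (\<exists>\<phi>. bij_betw \<phi> {F. F face_of P} {G. G face_of Q} \<and>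
      (\<forall>F F'. F face_of P \<longrightarrow> F' face_of P \<longrightarrow> (F \<subseteq> F' \<longleftrightarrow> \<phi> F' \<subseteq> \<phi> F)))"

definition simple_polytope :: "'a::euclidean_space set \<Rightarrow> bool" where
  "simple_polytope P \<longleftrightarrow> polytope P \<and>
    (\<forall>v. v extreme_point_of P \<longrightarrow> int (card {F. F facet_of P \<and> v \<in> F}) = aff_dim P)"

text \<open>The dual cyclic polytope is determined only up to combinatorial equivalence. The predicate
  describes all of its realizations; the polar of a translate of the cyclic polytope with the
  origin in its interior is one of them for every \<open>n \<ge> 5\<close>.\<close>

definition is_dual_cyclic4 :: "nat \<Rightarrow> (real ^ 4) set \<Rightarrow> bool" where
  "is_dual_cyclic4 n P \<longleftrightarrow>
    simple_polytope P \<and> aff_dim P = 4 \<and> combinatorially_dual P (cyclic_polytope4 n)"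

section \<open>Acyclic unique sink orientations\<close>

text \<open>An orientation is a set of directed edges; \<open>(v, w) \<in> A\<close> means that the edge of \<open>P\<close> joining
  the vertices \<open>v\<close> and \<open>w\<close> is directed from \<open>v\<close> to \<open>w\<close>.\<close>

definition adjacent :: "'a::euclidean_space set \<Rightarrow> 'a \<Rightarrow> 'a \<Rightarrow> bool" where
  "adjacent P v w \<longleftrightarrow>
    v extreme_point_of P \<and> w extreme_point_of P \<and> closed_segment v w edge_of P"

definition is_orientation :: "'a::euclidean_space set \<Rightarrow> ('a \<times> 'a) set \<Rightarrow> bool" where
  "is_orientation P A \<longleftrightarrow>
    (\<forall>v w. (v, w) \<in> A \<longrightarrow> adjacent P v w) \<and>
    (\<forall>v w. adjacent P v w \<longrightarrow> ((v, w) \<in> A \<longleftrightarrow> (w, v) \<notin> A))"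

text \<open>The out-neighbours of \<open>v\<close> in the subgraph induced by the face \<open>F\<close>. Heads of members of \<open>A\<close>
  are vertices of the polytope, and such a vertex is a vertex of \<open>F\<close> iff it lies in \<open>F\<close>.\<close>

definition out_nbrs :: "('a \<times> 'a) set \<Rightarrow> 'a set \<Rightarrow> 'a \<Rightarrow> 'a set" where
  "out_nbrs A F v = {w \<in> F. (v, w) \<in> A}"

definition is_sink :: "('a::euclidean_space \<times> 'a) set \<Rightarrow> 'a set \<Rightarrow> 'a \<Rightarrow> bool" where
  "is_sink A F v \<longleftrightarrow> v extreme_point_of F \<and> (\<forall>w \<in> F. (v, w) \<notin> A)"

definition is_source :: "('a::euclidean_space \<times> 'a) set \<Rightarrow> 'a set \<Rightarrow> 'a \<Rightarrow> bool" where
  "is_source A F v \<longleftrightarrow> v extreme_point_of F \<and> (\<forall>w \<in> F. (w, v) \<notin> A)"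

definition AUSO :: "'a::euclidean_space set \<Rightarrow> ('a \<times> 'a) set \<Rightarrow> bool" where
  "AUSO P A \<longleftrightarrow> is_orientation P A \<and> acyclic A \<and>
    (\<forall>F. F face_of P \<and> F \<noteq> {} \<longrightarrow> (\<exists>!v. is_sink A F v))"

definition global_source :: "'a::euclidean_space set \<Rightarrow> ('a \<times> 'a) set \<Rightarrow> 'a \<Rightarrow> bool" where
  "global_source P A s \<longleftrightarrow> is_source A P s \<and> (\<forall>v. is_source A P v \<longrightarrow> v = s)"

section \<open>The random facet rule\<close>

text \<open>\<open>random_facet A F v\<close> is the joint distribution of the vertex reached and the number of pivot
  steps made when the problem on the face \<open>F\<close> is solved starting from the vertex \<open>v\<close> of \<open>F\<close>. A
  nonterminating run would show up as missing mass. In an acyclic orientation of a simple polytope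
  there is none: the second branch makes a step, and if \<open>v\<close> has two or more out-neighbours in \<open>F\<close>,
  it is not the sink of any facet of \<open>F\<close> containing it, so that the third branch makes a step as
  well.\<close>

partial_function (spmf) random_facet ::
  "('a::euclidean_space \<times> 'a) set \<Rightarrow> 'a set \<Rightarrow> 'a \<Rightarrow> ('a \<times> nat) spmf" where
  "random_facet A F v =
    (if out_nbrs A F v = {} then return_spmf (v, 0)
     else if card (out_nbrs A F v) = 1 then
       bind_spmf (random_facet A F (the_elem (out_nbrs A F v))) (\<lambda>(u, m). return_spmf (u, Suc m))
     else
       bind_spmf (spmf_of_set {G. G facet_of F \<and> v \<in> G}) (\<lambda>G.
       bind_spmf (random_facet A G v) (\<lambda>(w, l).
       bind_spmf (random_facet A F w) (\<lambda>(u, m). return_spmf (u, l + m)))))"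

definition expected_pivot_steps ::
  "('a::euclidean_space \<times> 'a) set \<Rightarrow> 'a set \<Rightarrow> 'a \<Rightarrow> real" where
  "expected_pivot_steps A P s = (\<integral>x. real (snd x) \<partial>measure_spmf (random_facet A P s))"

end

theory Submission
  imports Defs "HOL-Computational_Algebra.Polynomial"
begin

text \<open>By Gale's evenness condition the vertices of the dual cyclic polytope are the pairs
  \<open>(x, y)\<close> of disjoint edges \<open>{x, x + 1}\<close>, \<open>{y, y + 1}\<close> of an \<open>n\<close>-cycle, and apart from the boundary
  a pivot moves one of the two edges by one step, so that the graph is a grid on a triangle
  \<open>x < y\<close>. Below the line \<open>y + x / 2 = n - 2\<close> the grid is oriented to the right, with columns pointing
  up for even \<open>x\<close> and down for odd \<open>x\<close>; above the line everything points down and to the left. This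
  orientation increases a potential and no two vertices are sinks of the same face. The facets have
  their sinks on the line and on the diagonal, in such an order that the run, whenever it has a
  choice at the bottom of an up-column or the top of a down-column, advances by at most two pairs of
  columns for every choice, while with probability \<open>1 / 4\<close> it is sent along its whole column.
  For linearly many columns this costs linearly many forced steps.\<close>

section \<open>Gale's evenness condition\<close>

text \<open>The obstacle is that a facet chosen at random might carry the run far ahead. A label
  \<open>i\<close> marks both column \<open>i\<close> and row \<open>i\<close>, so a label near
  \<open>n\<close> could have its sink in a column near \<open>n\<close>. The slanted line prevents
  this: it falls by one row for every two columns, so that label \<open>n - 1 - j\<close>, read as a
  row, has its sink already in column \<open>2 * j + 1\<close>, while a label met as a column has
  its sink in that very column. Hence all four labels at a vertex where the run has a choice have
  their sinks within the next two pairs of columns. The estimate follows the run inside a facet only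
  where it is forced along a column. Otherwise it uses that the run leaves a facet at its sink with
  certainty, so that a choice costs an average over four sinks, each of which still has the
  inductive bound ahead. Pair \<open>j\<close> of columns has height about \<open>n - 3 * j\<close>,
  so the pairs up to about \<open>n / 6\<close> keep a height of about \<open>n / 2\<close>. A
  realization \<open>P\<close> is known only through its face lattice and its dimension; vertices,
  edges and facets are therefore recovered from sets of labels.\<close>

text \<open>The index \<open>y = n - 1\<close> stands for the edge \<open>{n - 1, 0}\<close> of the cycle.\<close>

definition verts :: "nat \<Rightarrow> (nat \<times> nat) set" where
  "verts n = {(x, y). x + 2 \<le> y \<and> y < n \<and> (x, y) \<noteq> (0, n - 1)}"

definition gale :: "nat \<Rightarrow> nat \<times> nat \<Rightarrow> nat set" where
  "gale n = (\<lambda>(x, y). {x, Suc x, y, if Suc y = n then 0 else Suc y})"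

text \<open>The boundary complex of the cyclic polytope. Dually, its members are the sets of facets
  of \<open>P\<close> with a vertex in common.\<close>

definition gale_complex :: "nat \<Rightarrow> nat set set" where
  "gale_complex n = {S. \<exists>p\<in>verts n. S \<subseteq> gale n p}"

lemma gale_complex_subset: "S \<in> gale_complex n \<Longrightarrow> T \<subseteq> S \<Longrightarrow> T \<in> gale_complex n"
  unfolding gale_complex_def by blast

lemma gale_in_complex: "p \<in> verts n \<Longrightarrow> gale n p \<in> gale_complex n"
  unfolding gale_complex_def by blast

lemma gale_complexI:
  "x + 2 \<le> y \<Longrightarrow> y < n \<Longrightarrow> \<not> (x = 0 \<and> Suc y = n) \<Longrightarrow> Z \<subseteq> gale n (x, y) \<Longrightarrow> Z \<in> gale_complex n"
  unfolding gale_complex_def by (intro CollectI bexI[of _ "(x, y)"]) (auto simp: verts_def)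

lemma finite_verts: "finite (verts n)"
  by (rule finite_subset[of _ "{..<n} \<times> {..<n}"]) (auto simp: verts_def)

lemma finite_gale [simp]: "finite (gale n p)"
  by (auto simp: gale_def split: prod.splits)

lemma card_gale: "p \<in> verts n \<Longrightarrow> card (gale n p) = 4"
  by (auto simp: gale_def verts_def card_insert_if split: prod.splits)

lemma gale_subset: "p \<in> verts n \<Longrightarrow> gale n p \<subseteq> {..<n}"
  by (auto simp: gale_def verts_def split: prod.splits)

lemma gale_complex_finite: "S \<in> gale_complex n \<Longrightarrow> finite S"
  unfolding gale_complex_def using finite_gale finite_subset by blast

lemma gale_complex_card: "S \<in> gale_complex n \<Longrightarrow> card S \<le> 4"
  unfolding gale_complex_def by (auto dest!: card_mono[OF finite_gale] simp: card_gale)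

text \<open>A 4-set that consists of two disjoint edges of the cycle has maximal blocks of length 2
  or 4, and the ends of a block force the pairing. The case split is on which edge crosses the seam
  \<open>{n - 1, 0}\<close>.\<close>

lemma gale_inj:
  assumes "n \<ge> 6" "p \<in> verts n" "q \<in> verts n" "gale n p = gale n q"
  shows "p = q"
proof -
  obtain x y where p: "p = (x, y)" by (cases p)
  obtain z w where q: "q = (z, w)" by (cases q)
  note pq = p q
  have "{x, Suc x, y, if Suc y = n then 0 else Suc y} = {z, Suc z, w, if Suc w = n then 0 else Suc w}"
    using assms(4) unfolding gale_def pq prod.case .
  then have "\<And>i. i = x \<or> i = Suc x \<or> i = y \<or> i = (if Suc y = n then 0 else Suc y) \<longleftrightarrow>
      i = z \<or> i = Suc z \<or> i = w \<or> i = (if Suc w = n then 0 else Suc w)"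
    by blast
  note mem = this[of x] this[of "Suc x"] this[of y] this[of "Suc y"] this[of z] this[of "Suc z"]
    this[of w] this[of "Suc w"] this[of 0]
  have v: "x + 2 \<le> y" "y < n" "z + 2 \<le> w" "w < n" "\<not> (x = 0 \<and> Suc y = n)" "\<not> (z = 0 \<and> Suc w = n)"
    using assms(2,3) by (auto simp: pq verts_def)
  have "x = z \<and> y = w"
  proof (cases "Suc y = n"; cases "Suc w = n")
    assume c: "Suc y = n" "Suc w = n"
    then show ?thesis using mem(1,2,5,6) v assms(1) by auto
  next
    assume c: "Suc y = n" "Suc w \<noteq> n"
    have "z = 0" using mem(9) c v by auto
    moreover have "Suc w = y" using mem(3) c v calculation by auto
    ultimately show ?thesis using mem(6,7) c v assms(1) by auto
  next
    assume c: "Suc y \<noteq> n" "Suc w = n"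
    have "x = 0" using mem(9) c v by auto
    moreover have "Suc y = w" using mem(7) c v calculation by auto
    ultimately show ?thesis using mem(2,3) c v assms(1) by auto
  next
    assume c: "Suc y \<noteq> n" "Suc w \<noteq> n"
    then show ?thesis using mem(1,4,5,8) v by auto
  qed
  then show ?thesis by (simp add: pq)
qed

text \<open>\<open>nb1\<close> to \<open>nb4\<close> are the neighbours reached by dropping \<open>x\<close>, \<open>x + 1\<close>, \<open>y\<close> and \<open>y + 1\<close>,
  respectively.\<close>

definition nb1 :: "nat \<Rightarrow> nat \<times> nat \<Rightarrow> nat \<times> nat" where
  "nb1 n = (\<lambda>(x, y). if y = x + 2 then if Suc y = n then (0, n - 2) else (x + 1, y + 1) else (x + 1, y))"

definition nb2 :: "nat \<Rightarrow> nat \<times> nat \<Rightarrow> nat \<times> nat" where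
  "nb2 n = (\<lambda>(x, y). if x = 0 then (min y (n - 3), n - 1) else if x = 1 \<and> Suc y = n then (0, n - 2) else (x - 1, y))"

definition nb3 :: "nat \<Rightarrow> nat \<times> nat \<Rightarrow> nat \<times> nat" where
  "nb3 n = (\<lambda>(x, y). if Suc y = n then (0, max x 2) else if x = 0 \<and> y + 2 = n then (1, n - 1) else (x, y + 1))"

definition nb4 :: "nat \<Rightarrow> nat \<times> nat \<Rightarrow> nat \<times> nat" where
  "nb4 n = (\<lambda>(x, y). if y = x + 2 then if x = 0 then (1, n - 1) else (x - 1, y - 1) else (x, y - 1))"

lemmas nb_defs = nb1_def nb2_def nb3_def nb4_def

text \<open>The exceptional clauses of the four neighbours arise where the three surviving labels
  form one block, which must be extended at its other end, or where a surviving label has to be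
  paired across the seam. \<open>min y (n - 3)\<close> and \<open>max x 2\<close> merge the two
  situations.\<close>

lemma nb_verts:
  assumes "n \<ge> 6" "p \<in> verts n"
  shows "nb1 n p \<in> verts n" "nb2 n p \<in> verts n" "nb3 n p \<in> verts n" "nb4 n p \<in> verts n"
  using assms by (auto simp: verts_def nb_defs split: prod.splits if_splits)

context
  fixes n x y :: nat
  assumes n: "n \<ge> 6" and xy: "(x, y) \<in> verts n"
begin

private lemma vert_bounds: "x + 2 \<le> y" "y < n" "\<not> (x = 0 \<and> Suc y = n)"
  using xy by (auto simp: verts_def)

lemma gale_nb1: "gale n (x, y) - {x} \<subseteq> gale n (nb1 n (x, y))" "x \<notin> gale n (nb1 n (x, y))"
  using n vert_bounds by (cases "y = x + 2"; cases "Suc y = n"; auto simp: gale_def nb1_def)+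

lemma gale_nb2: "gale n (x, y) - {Suc x} \<subseteq> gale n (nb2 n (x, y))" "Suc x \<notin> gale n (nb2 n (x, y))"
proof -
  have "gale n (x, y) - {Suc x} \<subseteq> gale n (nb2 n (x, y)) \<and> Suc x \<notin> gale n (nb2 n (x, y))"
  proof -
    consider "x = 0" "y = n - 2" | "x = 0" "y \<le> n - 3" | "x = 1" "Suc y = n" | "x > 0" "\<not> (x = 1 \<and> Suc y = n)"
      using vert_bounds by linarith
    then show ?thesis
    proof cases
      case 1
      then have "nb2 n (x, y) = (n - 3, n - 1)" "Suc (n - 3) = n - 2" "Suc (n - 2) = n - 1" "Suc (n - 1) = n" "n - 3 \<ge> 3"
        using n by (auto simp: nb2_def)
      then show ?thesis using 1 by (auto simp: gale_def)
    next
      case 2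
      then have "nb2 n (x, y) = (y, n - 1)" "y \<ge> 2" "Suc (n - 1) = n" "n - 1 > 4"
        using vert_bounds n by (auto simp: nb2_def)
      then show ?thesis using 2 by (auto simp: gale_def)
    next
      case 3
      then have "nb2 n (x, y) = (0, n - 2)" "Suc (n - 2) = n - 1" "Suc (n - 1) = n" "y = n - 1" "n - 2 > 3"
        using n by (auto simp: nb2_def)
      then show ?thesis using 3 by (auto simp: gale_def)
    next
      case 4
      then have "nb2 n (x, y) = (x - 1, y)" "Suc (x - 1) = x"
        by (auto simp: nb2_def)
      then show ?thesis using 4 vert_bounds by (auto simp: gale_def)
    qed
  qed
  then show "gale n (x, y) - {Suc x} \<subseteq> gale n (nb2 n (x, y))" "Suc x \<notin> gale n (nb2 n (x, y))" by auto
qed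

lemma gale_nb3: "gale n (x, y) - {y} \<subseteq> gale n (nb3 n (x, y))" "y \<notin> gale n (nb3 n (x, y))"
  using n vert_bounds by (cases "x = 0"; cases "Suc y = n"; cases "x = 1"; cases "Suc (Suc y) = n"; auto simp add: gale_def nb3_def)+

lemma gale_nb4: "gale n (x, y) - {if Suc y = n then 0 else Suc y} \<subseteq> gale n (nb4 n (x, y))"
   "(if Suc y = n then 0 else Suc y) \<notin> gale n (nb4 n (x, y))"
  using n vert_bounds by (cases "x = 0"; cases "Suc y = n"; cases "y = x + 2"; auto simp add: gale_def nb4_def)+

end
text \<open>Every ridge lies in a second facet of the complex. This is what makes all subsets of a
  Gale set faces of the cyclic polytope.\<close>

lemma gale_flip:
  assumes "n \<ge> 6" "p \<in> verts n" "i \<in> gale n p"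
  shows "\<exists>q\<in>verts n. gale n p - {i} \<subseteq> gale n q \<and> i \<notin> gale n q"
proof -
  obtain x y where p: "p = (x, y)" by (cases p)
  note nbs = nb_verts[OF assms(1,2)[unfolded p]] 
    and flips = gale_nb1[OF assms(1,2)[unfolded p]] gale_nb2[OF assms(1,2)[unfolded p]]
      gale_nb3[OF assms(1,2)[unfolded p]] gale_nb4[OF assms(1,2)[unfolded p]]
  consider "i = x" | "i = Suc x" | "i = y" | "i = (if Suc y = n then 0 else Suc y)"
    using assms(3) unfolding p gale_def by auto
  then show ?thesis
  proof cases
    case 1
    show ?thesis unfolding p 1 by (intro bexI[OF _ nbs(1)] conjI flips)
  next
    case 2
    show ?thesis unfolding p 2 by (intro bexI[OF _ nbs(2)] conjI flips)
  next
    case 3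
    show ?thesis unfolding p 3 by (intro bexI[OF _ nbs(3)] conjI flips)
  next
    case 4
    show ?thesis unfolding p 4 by (intro bexI[OF _ nbs(4)] conjI flips)
  qed
qed

text \<open>The assumption excludes three indices that are pairwise non-adjacent on the cycle; such
  a set is covered by two disjoint edges. Away from the seam the cover is greedy: the edge starting
  at the minimum, then the edge starting at the first index not yet covered. The whole 5-cycle would
  be a counterexample, hence the bound on \<open>n\<close>.\<close>

lemma gale_complex_no_three_separated:
  assumes n: "n \<ge> 6" and Z: "Z \<subseteq> {..<n}"
    and sep: "\<And>a b c. a \<in> Z \<Longrightarrow> b \<in> Z \<Longrightarrow> c \<in> Z \<Longrightarrow> a + 2 \<le> b \<Longrightarrow> b + 2 \<le> c \<Longrightarrow> a = 0 \<and> Suc c = n"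
  shows "Z \<in> gale_complex n"
proof (cases "0 \<in> Z \<and> n - 1 \<in> Z")
  case True
  define R where "R = Z - {0, n - 1}"
  have fR: "finite R" using Z finite_subset unfolding R_def by blast
  show ?thesis
  proof (cases "R = {}")
    case True
    then have "Z \<subseteq> gale n (1, n - 1)" using n by (auto simp: R_def gale_def)
    then show ?thesis using n by (intro gale_complexI[of 1 "n - 1"]) auto
  next
    case False
    define b where "b = Min R"
    define c where "c = Max R"
    have b: "b \<in> R" "\<And>d. d \<in> R \<Longrightarrow> b \<le> d" and c: "c \<in> R" "\<And>d. d \<in> R \<Longrightarrow> d \<le> c"
      using fR False unfolding b_def c_def by auto
    have bc: "b \<in> Z" "c \<in> Z" "1 \<le> b" "b \<le> n - 2" "1 \<le> c" "c \<le> n - 2"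
      using b(1) c(1) Z n unfolding R_def by auto
    show ?thesis
    proof (cases "c \<le> b + 1")
      case True
      have "Z \<subseteq> {0, n - 1, b, b + 1}"
      proof
        fix d assume "d \<in> Z"
        then show "d \<in> {0, n - 1, b, b + 1}" using b(2)[of d] c(2)[of d] True by (auto simp: R_def)
      qed
      \<comment> \<open>For \<open>b = n - 2\<close> the edge \<open>{b, b + 1}\<close> would meet
        the seam edge, so the edge \<open>{n - 3, n - 2}\<close> is taken instead.\<close>
      then have "Z \<subseteq> gale n (min b (n - 3), n - 1)" using n bc by (auto simp: gale_def min_def)
      then show ?thesis using n bc by (intro gale_complexI[of "min b (n - 3)" "n - 1"]) auto
    next
      case F: False
      have b1: "b = 1" using sep[of 0 b c] True bc F n by force
      have c1: "c = n - 2" using sep[of b c "n - 1"] True bc F n by force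
      have "Z \<subseteq> {0, n - 1, 1, n - 2}"
      proof
        fix d assume d: "d \<in> Z"
        show "d \<in> {0, n - 1, 1, n - 2}"
        proof (rule ccontr)
          assume nd: "d \<notin> {0, n - 1, 1, n - 2}"
          \<comment> \<open>Such a \<open>d\<close> is separated from both \<open>0\<close> and
            \<open>n - 2\<close>, or from both \<open>1\<close> and \<open>n - 1\<close>; both fail
            only for \<open>d = 2 = n - 3\<close>, that is, for \<open>n = 5\<close>.\<close>
          then have "2 \<le> d" "d \<le> n - 3" using d Z by force+
          then show False using sep[of 0 d "n - 2"] sep[of 1 d "n - 1"] True bc b1 c1 d n by force
        qed
      qed
      then have "Z \<subseteq> gale n (0, n - 2)" using n by (auto simp: gale_def)
      then show ?thesis using n by (intro gale_complexI[of 0 "n - 2"]) auto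
    qed
  qed
next
  case F: False
  have fZ: "finite Z" using Z finite_subset by blast
  show ?thesis
  proof (cases "Z = {}")
    case True
    then show ?thesis using n by (intro gale_complexI[of 0 2]) auto
  next
    case ne: False
    define a where "a = Min Z"
    have a: "a \<in> Z" "\<And>d. d \<in> Z \<Longrightarrow> a \<le> d" using fZ ne unfolding a_def by auto
    have an: "a < n" using a Z by auto
    define R where "R = Z - {a, Suc a}"
    show ?thesis
    proof (cases "R = {}")
      case True
      then have Za: "Z \<subseteq> {a, Suc a}" by (auto simp: R_def)
      consider "a \<le> n - 3" | "a = n - 2" | "a = n - 1" using an by linarith
      then show ?thesis
      proof cases
        case 1
        have "Z \<subseteq> gale n (a, a + 2)" using Za by (auto simp: gale_def)
        then show ?thesis using n 1 by (intro gale_complexI[of a "a + 2"]) auto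
      next
        case 2
        have "Z \<subseteq> gale n (0, n - 2)" using Za 2 n by (auto simp: gale_def)
        then show ?thesis using n by (intro gale_complexI[of 0 "n - 2"]) auto
      next
        case 3
        have "Z \<subseteq> gale n (1, n - 1)" using Za 3 n Z by (auto simp: gale_def)
        then show ?thesis using n by (intro gale_complexI[of 1 "n - 1"]) auto
      qed
    next
      case False
      define b where "b = Min R"
      have "finite R" using fZ by (auto simp: R_def)
      then have b: "b \<in> R" "\<And>d. d \<in> R \<Longrightarrow> b \<le> d" using False unfolding b_def by auto
      have bZ: "b \<in> Z" "a + 2 \<le> b" "b < n" using b(1) a(2)[of b] Z by (auto simp: R_def)
      have "Z \<subseteq> {a, Suc a, b, Suc b}"
      proof
        fix d assume d: "d \<in> Z"
        show "d \<in> {a, Suc a, b, Suc b}"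
        proof (rule ccontr)
          assume nd: "d \<notin> {a, Suc a, b, Suc b}"
          then have "b + 2 \<le> d" using d b(2)[of d] by (auto simp: R_def)
          then show False using sep[of a b d] a d bZ F by auto
        qed
      qed
      then have "Z \<subseteq> gale n (a, b)" using Z bZ by (auto simp: gale_def)
      moreover have "(a, b) \<in> verts n" using bZ a F by (auto simp: verts_def)
      ultimately show ?thesis by (auto simp: gale_complex_def)
    qed
  qed
qed

text \<open>Splitting off the three zeros leaves an affine factor. The cubic factor alternates in
  sign at the interlacing points, so nonnegativity of the product forces the affine factor to change
  its sign weakly twice, and it vanishes.\<close>

lemma poly_alternating_nonneg:
  fixes q :: "real poly"
  assumes deg: "degree q \<le> 4"
    and zero: "poly q z1 = 0" "poly q z2 = 0" "poly q z3 = 0"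
    and ord: "(z1 < w1 \<and> w1 < z2 \<and> z2 < w2 \<and> w2 < z3 \<and> z3 < w3) \<or>
      (w1 < z1 \<and> z1 < w2 \<and> w2 < z2 \<and> z2 < w3 \<and> w3 < z3)"
    and nonneg: "poly q w1 \<ge> 0" "poly q w2 \<ge> 0" "poly q w3 \<ge> 0"
  shows "q = 0"
proof (rule ccontr)
  assume q0: "q \<noteq> 0"
  have lt: "z1 < z2" "z2 < z3" using ord by auto
  obtain q1 where q1: "q = [:-z1, 1:] * q1" using zero(1) poly_eq_0_iff_dvd by (metis dvdE)
  have "poly q1 z2 = 0" using zero(2) lt q1 by simp
  then obtain q2 where q2: "q1 = [:-z2, 1:] * q2" using poly_eq_0_iff_dvd by (metis dvdE)
  have "poly q2 z3 = 0" using zero(3) lt q1 q2 by simp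
  then obtain l where l: "q2 = [:-z3, 1:] * l" using poly_eq_0_iff_dvd by (metis dvdE)
  have q: "q = [:-z1, 1:] * ([:-z2, 1:] * ([:-z3, 1:] * l))" using q1 q2 l by simp
  have l0: "l \<noteq> 0" using q q0 by auto
  have "degree q = 3 + degree l" unfolding q using l0 by (simp add: degree_mult_eq del: mult_pCons_left)
  then have "degree l \<le> 1" using deg by simp
  then have "l = [:coeff l 0, coeff l 1:]"
    by (intro poly_eqI) (auto simp: coeff_pCons coeff_eq_0 split: nat.split)
  then obtain s t where st: "l = [:s, t:]" by blast
  have ql: "poly q w = ((w - z1) * (w - z2) * (w - z3)) * (s + t * w)" for w
    unfolding q st by (simp add: algebra_simps)
  have pos: "d \<ge> 0" if "0 \<le> c * d" "c > 0" for c d :: real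
    using that by (simp add: zero_le_mult_iff)
  have neg: "d \<le> 0" if "0 \<le> c * d" "c < 0" for c d :: real
    using that by (simp add: zero_le_mult_iff)
  have affine_zero: "u = 0 \<and> v = 0"
    if h: "u + v * w1 \<ge> 0" "u + v * w2 \<le> 0" "u + v * w3 \<ge> 0" and "w1 < w2" "w2 < w3" for u v
  proof -
    have "v * (w2 - w1) \<le> 0" using h(1,2) by (simp add: algebra_simps)
    then have "v \<le> 0" using that(4) by (simp add: mult_le_0_iff)
    moreover have "v * (w3 - w2) \<ge> 0" using h(2,3) by (simp add: algebra_simps)
    then have "v \<ge> 0" using that(5) by (simp add: zero_le_mult_iff)
    ultimately show ?thesis using h by simp
  qed
  have "s = 0 \<and> t = 0"
    using ord
  proof
    assume o: "z1 < w1 \<and> w1 < z2 \<and> z2 < w2 \<and> w2 < z3 \<and> z3 < w3"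
    have "s + t * w1 \<ge> 0" by (rule pos[OF nonneg(1)[unfolded ql]]) (use o in \<open>simp add: mult_pos_neg mult_neg_neg\<close>)
    moreover have "s + t * w2 \<le> 0" by (rule neg[OF nonneg(2)[unfolded ql]]) (use o in \<open>simp add: mult_pos_neg\<close>)
    moreover have "s + t * w3 \<ge> 0" by (rule pos[OF nonneg(3)[unfolded ql]]) (use o in simp)
    ultimately show ?thesis using affine_zero o by simp
  next
    assume o: "w1 < z1 \<and> z1 < w2 \<and> w2 < z2 \<and> z2 < w3 \<and> w3 < z3"
    have "s + t * w1 \<le> 0"
      by (rule neg[OF nonneg(1)[unfolded ql]]) (use o in \<open>simp add: mult_pos_neg mult_neg_neg\<close>)
    moreover have "s + t * w2 \<ge> 0" by (rule pos[OF nonneg(2)[unfolded ql]]) (use o in \<open>simp add: mult_pos_neg mult_neg_neg\<close>)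
    moreover have "s + t * w3 \<le> 0" by (rule neg[OF nonneg(3)[unfolded ql]]) (use o in \<open>simp add: mult_pos_neg\<close>)
    ultimately show ?thesis using affine_zero[of "-s" "-t"] o by simp
  qed
  then show False using l0 st by simp
qed

section \<open>The faces of the cyclic polytope\<close>

lemma vector_4:
  "(vector [x, y, z, w] :: 'a::zero ^ 4) $ 1 = x"
  "(vector [x, y, z, w] :: 'a::zero ^ 4) $ 2 = y"
  "(vector [x, y, z, w] :: 'a::zero ^ 4) $ 3 = z"
  "(vector [x, y, z, w] :: 'a::zero ^ 4) $ 4 = w"
  unfolding vector_def by simp_all

lemma inner_moment_curve4:
  "a \<bullet> moment_curve4 t = a $ 1 * t + a $ 2 * t ^ 2 + a $ 3 * t ^ 3 + a $ 4 * t ^ 4"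
  by (simp add: moment_curve4_def inner_vec_def sum_4 vector_4)

definition face_indices :: "nat \<Rightarrow> (real ^ 4) set \<Rightarrow> nat set" where
  "face_indices n F = {i \<in> {..<n}. moment_curve4 (real i) \<in> F}"

lemma face_indices_mono: "F \<subseteq> G \<Longrightarrow> face_indices n F \<subseteq> face_indices n G"
  by (auto simp: face_indices_def)

lemma face_indices_Int: "face_indices n (F \<inter> G) = face_indices n F \<inter> face_indices n G"
  by (auto simp: face_indices_def)

lemma cyclic_vertex_mem: "i < n \<Longrightarrow> moment_curve4 (real i) \<in> cyclic_polytope4 n"
  unfolding cyclic_polytope4_def by (intro hull_inc) simp

lemma polytope_cyclic: "polytope (cyclic_polytope4 n)"
  unfolding cyclic_polytope4_def by (simp add: polytope_convex_hull)

lemma convex_cyclic: "convex (cyclic_polytope4 n)"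
  unfolding cyclic_polytope4_def by simp

lemma face_indices_cyclic: "face_indices n (cyclic_polytope4 n) = {..<n}"
  by (auto simp: face_indices_def cyclic_vertex_mem)

text \<open>The extreme points of a face of a convex hull are among the generators. A face is thus
  determined by its indices, and inclusion of faces becomes inclusion of index sets.\<close>

lemma cyclic_face_eq_hull:
  assumes "F face_of cyclic_polytope4 n"
  shows "F = convex hull ((\<lambda>i. moment_curve4 (real i)) ` face_indices n F)"
proof
  have "finite ((\<lambda>i. moment_curve4 (real i)) ` {0..<n})" by simp
  from face_of_convex_hull_subset[OF finite_imp_compact[OF this] assms[unfolded cyclic_polytope4_def]]
  obtain S' where S': "S' \<subseteq> (\<lambda>i. moment_curve4 (real i)) ` {0..<n}" "F = convex hull S'" .
  have "S' \<subseteq> (\<lambda>i. moment_curve4 (real i)) ` face_indices n F"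
  proof
    fix v assume v: "v \<in> S'"
    then obtain i where "i < n" "v = moment_curve4 (real i)" using S'(1) by auto
    moreover have "v \<in> F" using v S'(2) hull_inc by metis
    ultimately show "v \<in> (\<lambda>i. moment_curve4 (real i)) ` face_indices n F"
      by (auto simp: face_indices_def)
  qed
  then show "F \<subseteq> convex hull ((\<lambda>i. moment_curve4 (real i)) ` face_indices n F)"
    using S'(2) hull_mono by metis
  show "convex hull ((\<lambda>i. moment_curve4 (real i)) ` face_indices n F) \<subseteq> F"
    using face_of_imp_convex[OF assms] by (intro hull_minimal) (auto simp: face_indices_def)
qed

lemma cyclic_face_subset_iff:
  assumes "F face_of cyclic_polytope4 n" "G face_of cyclic_polytope4 n"
  shows "F \<subseteq> G \<longleftrightarrow> face_indices n F \<subseteq> face_indices n G"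
proof
  assume "face_indices n F \<subseteq> face_indices n G"
  then have "convex hull ((\<lambda>i. moment_curve4 (real i)) ` face_indices n F)
      \<subseteq> convex hull ((\<lambda>i. moment_curve4 (real i)) ` face_indices n G)"
    by (intro hull_mono image_mono)
  then show "F \<subseteq> G" using cyclic_face_eq_hull[OF assms(1)] cyclic_face_eq_hull[OF assms(2)] by simp
qed (rule face_indices_mono)

text \<open>A supporting hyperplane is a polynomial of degree 4 that is nonnegative on the indices. Three
  pairwise non-adjacent zeros, together with neighbours of them on a common side, would interlace and
  force the polynomial to vanish.\<close>

lemma cyclic_face_indices_in_complex:
  assumes n: "n \<ge> 6" and F: "F face_of cyclic_polytope4 n" "F \<noteq> cyclic_polytope4 n"
  shows "face_indices n F \<in> gale_complex n"
proof (rule gale_complex_no_three_separated[OF n])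
  show "face_indices n F \<subseteq> {..<n}" by (auto simp: face_indices_def)
  have "F exposed_face_of cyclic_polytope4 n"
    using F exposed_face_of_polyhedron[OF polytope_imp_polyhedron[OF polytope_cyclic]] by blast
  then obtain a b where ab: "cyclic_polytope4 n \<subseteq> {x. a \<bullet> x \<le> b}"
      "F = cyclic_polytope4 n \<inter> {x. a \<bullet> x = b}"
    unfolding exposed_face_of_def by blast
  define q where "q = [:b, - a $ 1, - a $ 2, - a $ 3, - a $ 4:]"
  have q: "poly q t = b - a \<bullet> moment_curve4 t" for t
    by (simp add: q_def inner_moment_curve4 algebra_simps power2_eq_square power3_eq_cube power4_eq_xxxx)
  have nonneg: "poly q (real i) \<ge> 0" if "i < n" for i
    using ab(1) cyclic_vertex_mem[OF that] unfolding q by auto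
  have zero: "poly q (real i) = 0" if "i \<in> face_indices n F" for i
    using that ab(2) unfolding q face_indices_def by auto
  have deg: "degree q \<le> 4" by (simp add: q_def)
  have q0: "q \<noteq> 0"
  proof
    assume "q = 0"
    then have "b = 0" "a $ 1 = 0" "a $ 2 = 0" "a $ 3 = 0" "a $ 4 = 0" by (auto simp: q_def)
    then have "b = 0" "a = 0" by (auto simp: vec_eq_iff forall_4)
    then show False using ab(2) F(2) by simp
  qed
  fix z1 z2 z3 assume z: "z1 \<in> face_indices n F" "z2 \<in> face_indices n F" "z3 \<in> face_indices n F"
    "z1 + 2 \<le> z2" "z2 + 2 \<le> z3"
  have z3: "z3 < n" using z(3) by (auto simp: face_indices_def)
  show "z1 = 0 \<and> Suc z3 = n"
  proof (rule ccontr)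
    assume c: "\<not> (z1 = 0 \<and> Suc z3 = n)"
    show False
    \<comment> \<open>If \<open>z1 = 0\<close> there is no left neighbour, but then \<open>c\<close>
      leaves room to the right of \<open>z3\<close>; if \<open>z1 > 0\<close>, all three left
      neighbours are indices.\<close>
    proof (cases "z1 = 0")
      case True
      then have "q = 0" using c z z3
        by (intro poly_alternating_nonneg[OF deg zero[OF z(1)] zero[OF z(2)] zero[OF z(3)],
              of "real (z1 + 1)" "real (z2 + 1)" "real (z3 + 1)"] nonneg) auto
      then show False using q0 by simp
    next
      case False
      then have "q = 0" using c z z3
        by (intro poly_alternating_nonneg[OF deg zero[OF z(1)] zero[OF z(2)] zero[OF z(3)],
              of "real (z1 - 1)" "real (z2 - 1)" "real (z3 - 1)"] nonneg) auto
      then show False using q0 by simp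
    qed
  qed
qed

text \<open>Along the moment curve an affine functional is a polynomial of degree at most 4, so
  nonnegativity on the indices gives a supporting halfspace.\<close>

lemma cyclic_face_of_poly:
  assumes "degree p \<le> 4" and "\<And>i. i < n \<Longrightarrow> poly p (real i) \<ge> 0"
  shows "\<exists>F. F face_of cyclic_polytope4 n \<and> face_indices n F = {i. i < n \<and> poly p (real i) = 0}"
proof -
  define a :: "real ^ 4" where "a = vector [- coeff p 1, - coeff p 2, - coeff p 3, - coeff p 4]"
  have "poly p t = (\<Sum>i\<le>4. coeff p i * t ^ i)" for t
    unfolding poly_altdef using assms(1) by (intro sum.mono_neutral_left) (auto simp: coeff_eq_0)
  then have p: "poly p t = coeff p 0 - a \<bullet> moment_curve4 t" for t
    by (simp add: a_def inner_moment_curve4 vector_4 eval_nat_numeral)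
  have le: "cyclic_polytope4 n \<subseteq> {x. a \<bullet> x \<le> coeff p 0}"
    unfolding cyclic_polytope4_def
  proof (rule hull_minimal)
    show "(\<lambda>i. moment_curve4 (real i)) ` {0..<n} \<subseteq> {x. a \<bullet> x \<le> coeff p 0}"
      using assms(2) unfolding p by auto
  qed (rule convex_halfspace_le)
  let ?F = "cyclic_polytope4 n \<inter> {x. a \<bullet> x = coeff p 0}"
  have "?F face_of cyclic_polytope4 n"
    using le by (intro face_of_Int_supporting_hyperplane_le convex_cyclic) auto
  moreover have "face_indices n ?F = {i. i < n \<and> poly p (real i) = 0}"
    unfolding p by (auto simp: face_indices_def cyclic_vertex_mem)
  ultimately show ?thesis by blast
qed

lemma consecutive_product_nonneg: "(real i - real x) * (real i - (real x + 1)) \<ge> 0"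
proof (cases "i \<le> x")
  case False
  then have "real i \<ge> real x + 1" by linarith
  then show ?thesis by simp
qed (simp add: mult_nonpos_nonpos)

lemma cyclic_gale_face:
  assumes "v \<in> verts n"
  shows "\<exists>F. F face_of cyclic_polytope4 n \<and> face_indices n F = gale n v"
proof -
  obtain x y where v: "v = (x, y)" by (cases v)
  have xy: "x + 2 \<le> y" "y < n" "\<not> (x = 0 \<and> Suc y = n)" using assms by (auto simp: v verts_def)
  \<comment> \<open>Two consecutive integers as roots give a product that is nonnegative at every
    integer. For the seam edge the factor is \<open>t * (y - t)\<close>, which is nonnegative
    between its roots \<open>0\<close> and \<open>y = n - 1\<close>.\<close>
  define p where "p = (if Suc y = n
    then ([:- real x, 1:] * [:- (real x + 1), 1:]) * ([:0, 1:] * [:real y, - 1:])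
    else ([:- real x, 1:] * [:- (real x + 1), 1:]) * ([:- real y, 1:] * [:- (real y + 1), 1:]))"
  have ev: "poly p t = (if Suc y = n then ((t - real x) * (t - (real x + 1))) * (t * (real y - t))
      else ((t - real x) * (t - (real x + 1))) * ((t - real y) * (t - (real y + 1))))" for t
    by (simp add: p_def algebra_simps)
  have "degree p \<le> 4" by (simp add: p_def)
  moreover have "poly p (real i) \<ge> 0" if "i < n" for i
    using that unfolding ev by (auto intro!: mult_nonneg_nonneg consecutive_product_nonneg)
  ultimately obtain F where "F face_of cyclic_polytope4 n" "face_indices n F = {i. i < n \<and> poly p (real i) = 0}"
    using cyclic_face_of_poly by blast
  moreover have "poly p (real i) = 0 \<longleftrightarrow> i \<in> gale n v" if "i < n" for i
  proof -
    have e: "real i - real a = 0 \<longleftrightarrow> i = a" "real i - (real a + 1) = 0 \<longleftrightarrow> i = Suc a" "real a - real i = 0 \<longleftrightarrow> i = a"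
      "real i = 0 \<longleftrightarrow> i = 0" for a
      by linarith+
    show ?thesis unfolding ev v gale_def prod.case by (cases "Suc y = n") (simp_all only: if_True if_False mult_eq_0_iff e insert_iff empty_iff simp_thms, blast+)
  qed
  then have "{i. i < n \<and> poly p (real i) = 0} = gale n v" using gale_subset[OF assms] by auto
  ultimately show ?thesis by auto
qed

text \<open>Faces are closed under intersection, and intersecting with the neighbouring facet across
  a ridge removes exactly one label. Labels are removed one at a time in this way.\<close>

lemma cyclic_complex_face:
  assumes n: "n \<ge> 6" and S: "S \<in> gale_complex n"
  shows "\<exists>F. F face_of cyclic_polytope4 n \<and> F \<noteq> cyclic_polytope4 n \<and> face_indices n F = S"
proof -
  obtain v where v: "v \<in> verts n" "S \<subseteq> gale n v" using S by (auto simp: gale_complex_def)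
  have "\<exists>F. F face_of cyclic_polytope4 n \<and> face_indices n F = gale n v - T" if "finite T" "T \<subseteq> gale n v" for T
    using that
  proof (induction T)
    case empty
    then show ?case using cyclic_gale_face[OF v(1)] by simp
  next
    case (insert i T)
    then obtain F where F: "F face_of cyclic_polytope4 n" "face_indices n F = gale n v - T" by auto
    obtain w where w: "w \<in> verts n" "gale n v - {i} \<subseteq> gale n w" "i \<notin> gale n w"
      using gale_flip[OF n v(1), of i] insert.prems by auto
    obtain G where G: "G face_of cyclic_polytope4 n" "face_indices n G = gale n w"
      using cyclic_gale_face[OF w(1)] by blast
    have "face_indices n (F \<inter> G) = gale n v - insert i T"
      unfolding face_indices_Int F G using w by auto
    then show ?case using face_of_Int[OF F(1) G(1)] by blast
  qed
  from this[of "gale n v - S"] obtain F where F: "F face_of cyclic_polytope4 n" "face_indices n F = S"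
    using v(2) by (auto simp: double_diff)
  moreover have "F \<noteq> cyclic_polytope4 n"
  proof
    assume "F = cyclic_polytope4 n"
    then have "S = {..<n}" using F(2) face_indices_cyclic[of n] by simp
    then have "card S = n" by simp
    then show False using gale_complex_card[OF S] n by simp
  qed
  ultimately show ?thesis by blast
qed

section \<open>Pivots, potential and outgoing directions\<close>

definition flip :: "nat \<Rightarrow> nat \<times> nat \<Rightarrow> nat \<Rightarrow> nat \<times> nat" where
  "flip n p i = (if i = fst p then nb1 n p else if i = Suc (fst p) then nb2 n p
     else if i = snd p then nb3 n p else nb4 n p)"

lemma flip:
  assumes n: "n \<ge> 6" and p: "p \<in> verts n" and i: "i \<in> gale n p"
  shows "flip n p i \<in> verts n" "gale n p - {i} \<subseteq> gale n (flip n p i)" "i \<notin> gale n (flip n p i)"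
proof -
  obtain x y where xy: "p = (x, y)" by (cases p)
  have d: "x + 2 \<le> y" "y < n" "\<not> (x = 0 \<and> Suc y = n)" using p by (auto simp: xy verts_def)
  note nbs = nb_verts[OF n p[unfolded xy]]
    and flips = gale_nb1[OF n p[unfolded xy]] gale_nb2[OF n p[unfolded xy]]
      gale_nb3[OF n p[unfolded xy]] gale_nb4[OF n p[unfolded xy]]
  consider "i = x" "flip n (x, y) x = nb1 n (x, y)" | "i = Suc x" "flip n (x, y) (Suc x) = nb2 n (x, y)"
    | "i = y" "flip n (x, y) y = nb3 n (x, y)"
    | "i = (if Suc y = n then 0 else Suc y)"
      "flip n (x, y) (if Suc y = n then 0 else Suc y) = nb4 n (x, y)"
    using i d unfolding xy gale_def flip_def by (auto split: if_splits)
  then have "flip n p i \<in> verts n \<and> gale n p - {i} \<subseteq> gale n (flip n p i) \<and> i \<notin> gale n (flip n p i)"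
  proof cases
    case 1
    show ?thesis unfolding 1 xy by (intro conjI flips nbs)
  next
    case 2
    show ?thesis unfolding 2 xy by (intro conjI flips nbs)
  next
    case 3
    show ?thesis unfolding 3 xy by (intro conjI flips nbs)
  next
    case 4
    show ?thesis unfolding 4 xy by (intro conjI flips nbs)
  qed
  then show "flip n p i \<in> verts n" "gale n p - {i} \<subseteq> gale n (flip n p i)" "i \<notin> gale n (flip n p i)" by auto
qed

text \<open>Since \<open>x div 2\<close> is constant on the columns \<open>2 * j\<close> and
  \<open>2 * j + 1\<close>, both reach up to row \<open>n - 2 - j\<close>; the line drops only on
  entering the next even column.\<close>

definition low :: "nat \<Rightarrow> nat \<times> nat \<Rightarrow> bool" where
  "low n = (\<lambda>(x, y). y + x div 2 + 2 \<le> n)"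

text \<open>Every pivot from the complement of \<open>low\<close> into \<open>low\<close> is outgoing, hence the offset \<open>3 * n\<close>.\<close>

definition pot :: "nat \<Rightarrow> nat \<times> nat \<Rightarrow> nat" where
  "pot n = (\<lambda>(x, y). if low n (x, y) then 3 * n + x * n + (if even x then y else n - y) else 2 * n - (x + y))"

text \<open>The elements of \<open>gale n p\<close> that can be dropped to increase the potential.\<close>

definition outs :: "nat \<Rightarrow> nat \<times> nat \<Rightarrow> nat set" where
  "outs n = (\<lambda>(x, y). if low n (x, y)
     then {i. i = x \<and> low n (nb1 n (x, y)) \<or> i = y \<and> even x \<and> low n (x, y + 1) \<or> i = Suc y \<and> odd x \<and> x + 3 \<le> y}
     else {i. i = Suc x \<or> i = (if Suc y = n then 0 else Suc y) \<or> i = y \<and> Suc y = n \<or> i = x \<and> y = x + 2 \<and> Suc y = n})"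

lemma outs_subset:
  assumes "p \<in> verts n"
  shows "outs n p \<subseteq> gale n p"
proof -
  obtain x y where xy: "p = (x, y)" by (cases p)
  show ?thesis unfolding xy outs_def gale_def low_def by auto
qed

text \<open>The term for the height lies strictly between \<open>0\<close> and \<open>n\<close>, so
  a change of column, worth \<open>n\<close>, decides the comparison. Leaving the low region drops
  the potential from at least \<open>3 * n\<close> to at most \<open>2 * n\<close>.\<close>

lemma pot_flip_low:
  assumes n: "n \<ge> 6" and p: "(x, y) \<in> verts n" and i: "i \<in> gale n (x, y)" and l: "low n (x, y)"
  shows "(pot n (x, y) < pot n (flip n (x, y) i) \<longleftrightarrow> i \<in> outs n (x, y)) \<and> pot n (x, y) \<noteq> pot n (flip n (x, y) i)"
proof -
  have d: "x + 2 \<le> y" "Suc y < n" "y + x div 2 + 2 \<le> n" using p l by (auto simp: verts_def low_def)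
  have dist: "x \<noteq> Suc x" "x \<noteq> y" "x \<noteq> Suc y" "Suc x \<noteq> y" "Suc x \<noteq> Suc y" "y \<noteq> Suc y" using d by auto
  have gt: "pot n (x, y) \<ge> 3 * n" using l by (simp add: pot_def)
  have high: "pot n q \<le> 2 * n" if "\<not> low n q" for q using that by (cases q) (auto simp: pot_def)
  have n0: "n > 0" using n by simp
  consider "i = x" | "i = Suc x" | "i = y" | "i = Suc y"
    using i d by (auto simp: gale_def)
  then show ?thesis
  proof cases
    case 1
    have f: "flip n (x, y) i = nb1 n (x, y)" using 1 by (simp add: flip_def)
    have o: "i \<in> outs n (x, y) \<longleftrightarrow> low n (nb1 n (x, y))" using 1 l dist by (simp add: outs_def)
    show ?thesis
    proof (cases "low n (nb1 n (x, y))")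
      case True
      have "pot n (x, y) < pot n (nb1 n (x, y))"
      proof (cases "y = x + 2")
        case c: True
        have "nb1 n (x, y) = (Suc x, Suc y)" using c d by (simp add: nb1_def)
        then show ?thesis using True l d by (auto simp: pot_def)
      next
        case False
        have "nb1 n (x, y) = (Suc x, y)" using False d by (simp add: nb1_def)
        then show ?thesis using True l d by (auto simp: pot_def)
      qed
      then show ?thesis using True f o by simp
    next
      case False
      then show ?thesis using f o high[OF False] gt n0 by simp
    qed
  next
    case 2
    have f: "flip n (x, y) i = nb2 n (x, y)" using 2 by (simp add: flip_def)
    have o: "i \<notin> outs n (x, y)" using 2 l dist by (simp add: outs_def)
    have "pot n (nb2 n (x, y)) < pot n (x, y)"
    proof (cases x)
      case 0
      have "\<not> low n (nb2 n (x, y))" using 0 d n by (auto simp: nb2_def low_def)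
      then show ?thesis using high gt n0 by fastforce
    next
      case (Suc z)
      have nb: "nb2 n (x, y) = (z, y)" using Suc d by (simp add: nb2_def)
      have "low n (z, y)" using d div_le_mono[of z x 2] Suc by (simp add: low_def)
      then show ?thesis using l d Suc unfolding nb by (auto simp: pot_def)
    qed
    then show ?thesis using f o by simp
  next
    case 3
    have f: "flip n (x, y) i = nb3 n (x, y)" using 3 d by (simp add: flip_def)
    have o: "i \<in> outs n (x, y) \<longleftrightarrow> even x \<and> low n (x, y + 1)" using 3 l dist by (simp add: outs_def)
    show ?thesis
    proof (cases "low n (nb3 n (x, y))")
      case True
      have nb: "nb3 n (x, y) = (x, y + 1)" using True d n by (auto simp: nb3_def low_def split: if_splits)
      then show ?thesis using True l d unfolding f o nb by (auto simp: pot_def)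
    next
      case False
      have "\<not> low n (x, y + 1)"
      proof
        assume a: "low n (x, y + 1)"
        then have "nb3 n (x, y) = (x, y + 1)" using d n by (auto simp: nb3_def low_def)
        then show False using a False by simp
      qed
      then show ?thesis using f o high[OF False] gt n0 by simp
    qed
  next
    case 4
    have f: "flip n (x, y) i = nb4 n (x, y)" using 4 d by (simp add: flip_def)
    have o: "i \<in> outs n (x, y) \<longleftrightarrow> odd x \<and> x + 3 \<le> y" using 4 l dist by (auto simp: outs_def)
    show ?thesis
    proof (cases "x + 3 \<le> y")
      case True
      then have nb: "nb4 n (x, y) = (x, y - 1)" by (simp add: nb4_def)
      have "low n (x, y - 1)" using d by (simp add: low_def)
      then show ?thesis using True l d unfolding f o nb by (auto simp: pot_def)
    next
      case False
      have "pot n (nb4 n (x, y)) < pot n (x, y)"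
      proof (cases x)
        case 0
        have "\<not> low n (nb4 n (x, y))" using 0 d n False by (auto simp: nb4_def low_def)
        then show ?thesis using high gt n0 by fastforce
      next
        case (Suc z)
        have nb: "nb4 n (x, y) = (z, y - 1)" using Suc d False by (simp add: nb4_def)
        have "low n (z, y - 1)" using d div_le_mono[of z x 2] Suc by (simp add: low_def)
        then show ?thesis using l d Suc unfolding nb by (auto simp: pot_def)
      qed
      then show ?thesis using f o False by simp
    qed
  qed
qed

text \<open>Here a pivot is outgoing iff it lowers \<open>x + y\<close> or enters the low region.
  Besides the two steps down and left, this happens for jumps across the seam, which account for the
  two extra clauses in \<open>outs\<close>.\<close>

lemma pot_flip_high:
  assumes n: "n \<ge> 6" and p: "(x, y) \<in> verts n" and i: "i \<in> gale n (x, y)" and h: "\<not> low n (x, y)"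
  shows "(pot n (x, y) < pot n (flip n (x, y) i) \<longleftrightarrow> i \<in> outs n (x, y)) \<and> pot n (x, y) \<noteq> pot n (flip n (x, y) i)"
proof -
  have d: "x + 2 \<le> y" "y < n" "y + x div 2 + 2 > n" using p h by (auto simp: verts_def low_def)
  have x0: "x > 0" using d p by (cases x) (auto simp: verts_def)
  have le: "pot n (x, y) < 2 * n" "pot n (x, y) = 2 * n - (x + y)" using h x0 n by (auto simp: pot_def)
  have lowgt: "pot n q \<ge> 3 * n" if "low n q" for q using that by (cases q) (auto simp: pot_def)
  have less: "pot n (x, y) < pot n (z, w)" if "z + w < x + y" for z w
    using that lowgt[of "(z, w)"] le d by (cases "low n (z, w)") (auto simp: pot_def)
  have w: "(if Suc y = n then 0 else Suc y) \<noteq> x" "(if Suc y = n then 0 else Suc y) \<noteq> Suc x"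
    "(if Suc y = n then 0 else Suc y) \<noteq> y" using x0 d by auto
  consider "i = x" | "i = Suc x" | "i = y" | "i = (if Suc y = n then 0 else Suc y)"
    using i by (auto simp: gale_def)
  then show ?thesis
  proof cases
    case 1
    have f: "flip n (x, y) i = nb1 n (x, y)" using 1 by (simp add: flip_def)
    have o: "i \<in> outs n (x, y) \<longleftrightarrow> y = x + 2 \<and> Suc y = n" using 1 h w x0 d by (auto simp: outs_def)
    show ?thesis
    proof (cases "y = x + 2 \<and> Suc y = n")
      case True
      then have "nb1 n (x, y) = (0, n - 2)" by (simp add: nb1_def)
      then show ?thesis using o f True less[of 0 "n - 2"] n by auto
    next
      case False
      have "\<exists>y'\<ge>y. nb1 n (x, y) = (Suc x, y')" using False by (auto simp: nb1_def)
      then obtain y' where nb: "nb1 n (x, y) = (Suc x, y')" "y \<le> y'" by blast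
      then have "y' + Suc x div 2 + 2 > n" using d div_le_mono[of x "Suc x" 2] by linarith
      then have "\<not> low n (Suc x, y')" by (simp add: low_def)
      then have "pot n (Suc x, y') < pot n (x, y)" using le nb d by (auto simp: pot_def)
      then show ?thesis using o f False nb by auto
    qed
  next
    case 2
    have f: "flip n (x, y) i = nb2 n (x, y)" using 2 by (simp add: flip_def)
    have o: "i \<in> outs n (x, y)" using 2 h by (simp add: outs_def)
    have "pot n (x, y) < pot n (nb2 n (x, y))" using x0 d less by (auto simp: nb2_def)
    then show ?thesis using o f by auto
  next
    case 3
    have f: "flip n (x, y) i = nb3 n (x, y)" using 3 d by (simp add: flip_def)
    have o: "i \<in> outs n (x, y) \<longleftrightarrow> Suc y = n" using 3 h w x0 d by (auto simp: outs_def)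
    show ?thesis
    proof (cases "Suc y = n")
      case True
      have "nb3 n (x, y) = (0, max x 2)" using True by (simp add: nb3_def)
      moreover have "max x 2 < x + y" using x0 d by auto
      ultimately show ?thesis using o f True less[of 0 "max x 2"] by auto
    next
      case False
      have nb: "nb3 n (x, y) = (x, Suc y)" using False d x0 by (auto simp: nb3_def)
      have "\<not> low n (x, Suc y)" using d by (simp add: low_def)
      then have "pot n (x, Suc y) < pot n (x, y)" using le d by (auto simp: pot_def)
      then show ?thesis using o f False nb by auto
    qed
  next
    case 4
    have f: "flip n (x, y) i = nb4 n (x, y)" using 4 w by (simp add: flip_def)
    have o: "i \<in> outs n (x, y)" using 4 h by (simp add: outs_def)
    have "pot n (x, y) < pot n (nb4 n (x, y))" using x0 d less by (auto simp: nb4_def)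
    then show ?thesis using o f by auto
  qed
qed

lemma pot_flip:
  assumes "n \<ge> 6" "p \<in> verts n" "i \<in> gale n p"
  shows "pot n p < pot n (flip n p i) \<longleftrightarrow> i \<in> outs n p" "pot n p \<noteq> pot n (flip n p i)"
  using assms pot_flip_low pot_flip_high by (cases p; metis)+

section \<open>No two vertices are sinks of a common face\<close>

lemma outs_unique_high:
  assumes n: "n \<ge> 6" and p: "(x, y) \<in> verts n" and q: "(z, w) \<in> verts n"
    and l: "\<not> low n (x, y)" "\<not> low n (z, w)"
    and s: "outs n (x, y) \<subseteq> gale n (z, w)" "outs n (z, w) \<subseteq> gale n (x, y)"
  shows "x = z \<and> y = w"
proof -
  have d: "x + 2 \<le> y" "y < n" "z + 2 \<le> w" "w < n" "x > 0" "z > 0"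
    using p q l by (auto simp: verts_def low_def intro: gr0I)
  have m: "Suc x \<in> gale n (z, w)" "(if Suc y = n then 0 else Suc y) \<in> gale n (z, w)"
    "Suc z \<in> gale n (x, y)" "(if Suc w = n then 0 else Suc w) \<in> gale n (x, y)"
    using s l by (auto simp: outs_def)
  consider "Suc y = n" "Suc w = n" | "Suc y = n" "Suc w \<noteq> n" | "Suc y \<noteq> n" "Suc w = n" | "Suc y \<noteq> n" "Suc w \<noteq> n"
    by blast
  then show ?thesis
    by cases (use m d in \<open>auto simp: gale_def\<close>)
qed

text \<open>The labels \<open>z + 1\<close> and \<open>w + 1\<close> would place
  \<open>(z, w)\<close> weakly below and to the left of a low vertex, and \<open>low\<close> is
  closed under moving down and left. At the seam only \<open>(x, y) = (0, n - 2)\<close> with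
  \<open>(z, w) = (n - 3, n - 1)\<close> remains, and the additional outgoing label \<open>z\<close>
  of that vertex excludes it.\<close>

lemma outs_unique_low_high:
  assumes n: "n \<ge> 6" and p: "(x, y) \<in> verts n" and q: "(z, w) \<in> verts n"
    and l: "low n (x, y)" "\<not> low n (z, w)"
    and s: "outs n (z, w) \<subseteq> gale n (x, y)"
  shows False
proof -
  have d: "x + 2 \<le> y" "Suc y < n" "z + 2 \<le> w" "w < n" "z > 0" "y + x div 2 + 2 \<le> n" "w + z div 2 + 2 > n"
    using p q l by (auto simp: verts_def low_def intro: gr0I)
  have m: "Suc z \<in> gale n (x, y)" "(if Suc w = n then 0 else Suc w) \<in> gale n (x, y)"
    "Suc w = n \<Longrightarrow> w \<in> gale n (x, y)" "w = z + 2 \<Longrightarrow> Suc w = n \<Longrightarrow> z \<in> gale n (x, y)"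
    using s l by (auto simp: outs_def)
  show False
  proof (cases "Suc w = n")
    case True
    then have "x = 0" "Suc y = w" using m(2,3) d by (auto simp: gale_def)
    moreover have "Suc z = y" using m(1) d calculation by (auto simp: gale_def)
    ultimately show False using m(4) True n d by (auto simp: gale_def)
  next
    case False
    then have "z \<le> x" "w \<le> y" using m(1,2) d by (auto simp: gale_def)
    then show False using d div_le_mono[of z x 2] by linarith
  qed
qed

text \<open>As \<open>x\<close> is not a label of the vertex further right, stepping right from
  \<open>(x, y)\<close> must leave the low region. Off the diagonal this occurs only at the top of
  an odd column, where the downward label \<open>Suc y\<close> is outgoing; as a label of
  \<open>(z, w)\<close> it gives \<open>w\<close> at least \<open>y\<close>, beyond the line. On the
  diagonal \<open>w\<close> is high enough anyway.\<close>

lemma outs_unique_low_less: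
  assumes n: "n \<ge> 6" and p: "(x, y) \<in> verts n" and q: "(z, w) \<in> verts n"
    and l: "low n (x, y)" "low n (z, w)"
    and s: "outs n (x, y) \<subseteq> gale n (z, w)" "x < z"
  shows False
proof -
  have d: "x + 2 \<le> y" "Suc y < n" "z + 2 \<le> w" "Suc w < n" "y + x div 2 + 2 \<le> n" "w + z div 2 + 2 \<le> n"
    using p q l by (auto simp: verts_def low_def)
  have zx: "Suc x div 2 \<le> z div 2" using s(2) by (intro div_le_mono) simp
  have "x \<notin> gale n (z, w)" using d s by (auto simp: gale_def)
  then have "x \<notin> outs n (x, y)" using s by blast
  then have nl: "\<not> low n (nb1 n (x, y))" using l by (simp add: outs_def)
  show False
  proof (cases "y = x + 2")
    case True
    then show ?thesis using nl d zx s by (auto simp: nb1_def low_def)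
  next
    case False
    then have t: "y + Suc x div 2 + 2 > n" using nl by (auto simp: nb1_def low_def)
    have "odd x"
    proof
      assume "even x"
      then have "Suc x div 2 = x div 2" by presburger
      then show False using t d by simp
    qed
    then have "Suc y \<in> gale n (z, w)" using s l d False by (auto simp: outs_def)
    then show False using d t zx s by (auto simp: gale_def)
  qed
qed

text \<open>A column is a directed path: its direction provides one of the two vertices with an
  outgoing label that the other one lacks.\<close>

lemma outs_unique_low_same:
  assumes p: "(x, y) \<in> verts n" and q: "(x, w) \<in> verts n"
    and l: "low n (x, y)" "low n (x, w)"
    and s: "outs n (x, y) \<subseteq> gale n (x, w)" "outs n (x, w) \<subseteq> gale n (x, y)" "y < w"
  shows False
proof -
  have d: "x + 2 \<le> y" "Suc y < n" "x + 2 \<le> w" "Suc w < n" "y + x div 2 + 2 \<le> n" "w + x div 2 + 2 \<le> n"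
    using p q l by (auto simp: verts_def low_def)
  show False
  proof (cases "even x")
    case True
    have "low n (x, y + 1)" using d s by (simp add: low_def)
    then have "y \<in> gale n (x, w)" using s True l by (auto simp: outs_def)
    then show False using d s by (auto simp: gale_def)
  next
    case False
    then have "Suc w \<in> gale n (x, y)" using s l d by (auto simp: outs_def)
    then show False using d s by (auto simp: gale_def)
  qed
qed

text \<open>If \<open>p\<close> and \<open>q\<close> are both sinks of the face \<open>S\<close>,
  then \<open>outs n p \<subseteq> S \<subseteq> gale n q\<close> and conversely. Stated this way,
  the condition does not mention \<open>S\<close>.\<close>

lemma outs_unique:
  assumes n: "n \<ge> 6" and p: "p \<in> verts n" and q: "q \<in> verts n"
    and s: "outs n p \<subseteq> gale n q" "outs n q \<subseteq> gale n p"
  shows "p = q"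
proof -
  obtain x y where xy: "p = (x, y)" by (cases p)
  obtain z w where zw: "q = (z, w)" by (cases q)
  note a = p[unfolded xy] q[unfolded zw] and t = s[unfolded xy zw]
  consider "\<not> low n (x, y)" "\<not> low n (z, w)" | "low n (x, y)" "\<not> low n (z, w)" | "\<not> low n (x, y)" "low n (z, w)"
    | "low n (x, y)" "low n (z, w)" by blast
  then show ?thesis
  proof cases
    case 1
    show ?thesis using outs_unique_high[OF n a 1 t] by (simp add: xy zw)
  next
    case 2
    show ?thesis using outs_unique_low_high[OF n a 2 t(2)] by simp
  next
    case 3
    show ?thesis using outs_unique_low_high[OF n a(2,1) 3(2,1) t(1)] by simp
  next
    case 4
    have "x = z"
      using outs_unique_low_less[OF n a 4 t(1)] outs_unique_low_less[OF n a(2,1) 4(2,1) t(2)] by (meson linorder_neqE_nat)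
    moreover have "y = w"
      using outs_unique_low_same[of x y n w] outs_unique_low_same[of x w n y] a 4 t calculation
      by (metis linorder_neqE_nat)
    ultimately show ?thesis by (simp add: xy zw)
  qed
qed

section \<open>The random facet rule\<close>

lemma nn_integral_bind_spmf:
  "(\<integral>\<^sup>+ x. f x \<partial>measure_spmf (bind_spmf p g)) = (\<integral>\<^sup>+ x. \<integral>\<^sup>+ y. f y \<partial>measure_spmf (g x) \<partial>measure_spmf p)"
  unfolding measure_spmf_bind by (subst nn_integral_bind[where B = "count_space UNIV"]) (auto simp: o_def)

lemma nn_integral_return_spmf: "(\<integral>\<^sup>+ x. f x \<partial>measure_spmf (return_spmf y)) = f y"
  unfolding measure_spmf_return_spmf by (subst nn_integral_return) auto

lemma nn_integral_lossless_add_const: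
  assumes "lossless_spmf p"
  shows "(\<integral>\<^sup>+ x. c + f x \<partial>measure_spmf p) = c + (\<integral>\<^sup>+ x. f x \<partial>measure_spmf p)"
proof -
  have "(\<integral>\<^sup>+ x. c + f x \<partial>measure_spmf p) = (\<integral>\<^sup>+ x. c \<partial>measure_spmf p) + (\<integral>\<^sup>+ x. f x \<partial>measure_spmf p)"
    by (rule nn_integral_add) auto
  moreover have "emeasure (measure_spmf p) UNIV = 1"
    using assms by (simp add: lossless_spmf_def measure_spmf.emeasure_eq_measure space_measure_spmf)
  ultimately show ?thesis by (simp add: space_measure_spmf)
qed

lemma random_facet_sink:
  assumes "out_nbrs A F v = {}"
  shows "random_facet A F v = return_spmf (v, 0)"
  by (subst random_facet.simps) (simp add: assms)

lemma random_facet_forced: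
  assumes "out_nbrs A F v = {w}"
  shows "random_facet A F v = bind_spmf (random_facet A F w) (\<lambda>(u, m). return_spmf (u, Suc m))"
  by (subst random_facet.simps) (simp add: assms)

lemma random_facet_choose:
  assumes "out_nbrs A F v \<noteq> {}" "card (out_nbrs A F v) \<noteq> 1"
  shows "random_facet A F v = bind_spmf (spmf_of_set {G. G facet_of F \<and> v \<in> G}) (\<lambda>G.
       bind_spmf (random_facet A G v) (\<lambda>(w, l).
       bind_spmf (random_facet A F w) (\<lambda>(u, m). return_spmf (u, l + m))))"
  by (subst random_facet.simps) (simp only: assms if_False)

text \<open>Used with \<open>g = fst\<close> and a singleton \<open>W\<close>, to carry termination,
  finite support and the certain endpoint through the recursion together.\<close>

lemma terminating_bind:
  assumes "lossless_spmf p \<and> finite (set_spmf p)"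
    and "\<And>x. x \<in> set_spmf p \<Longrightarrow> lossless_spmf (f x) \<and> finite (set_spmf (f x)) \<and> g ` set_spmf (f x) \<subseteq> W"
  shows "lossless_spmf (bind_spmf p f) \<and> finite (set_spmf (bind_spmf p f)) \<and> g ` set_spmf (bind_spmf p f) \<subseteq> W"
proof (intro conjI)
  show "lossless_spmf (bind_spmf p f)" using assms by simp
  show "finite (set_spmf (bind_spmf p f))" using assms by (simp add: set_bind_spmf bind_UNION)
  show "g ` set_spmf (bind_spmf p f) \<subseteq> W" using assms(2) by (simp add: set_bind_spmf bind_UNION) blast
qed

section \<open>Faces of the dual cyclic polytope\<close>

locale dual_cyclic =
  fixes n :: nat and P :: "(real ^ 4) set"
  assumes n_ge: "n \<ge> 6" and dual: "is_dual_cyclic4 n P"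
begin

lemma polytope_P: "polytope P"
  using dual by (simp add: is_dual_cyclic4_def simple_polytope_def)

lemma aff_dim_P: "aff_dim P = 4"
  using dual by (simp add: is_dual_cyclic4_def)

lemma P_nonempty: "P \<noteq> {}"
  using aff_dim_P by auto

definition dual_map :: "(real ^ 4) set \<Rightarrow> (real ^ 4) set" where
  "dual_map = (SOME \<phi>. bij_betw \<phi> {F. F face_of P} {G. G face_of cyclic_polytope4 n} \<and>
      (\<forall>F F'. F face_of P \<longrightarrow> F' face_of P \<longrightarrow> (F \<subseteq> F' \<longleftrightarrow> \<phi> F' \<subseteq> \<phi> F)))"

lemma dual_map:
  "bij_betw dual_map {F. F face_of P} {G. G face_of cyclic_polytope4 n}"
  "F face_of P \<Longrightarrow> F' face_of P \<Longrightarrow> F \<subseteq> F' \<longleftrightarrow> dual_map F' \<subseteq> dual_map F"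
proof -
  have "\<exists>\<phi>. bij_betw \<phi> {F. F face_of P} {G. G face_of cyclic_polytope4 n} \<and>
      (\<forall>F F'. F face_of P \<longrightarrow> F' face_of P \<longrightarrow> (F \<subseteq> F' \<longleftrightarrow> \<phi> F' \<subseteq> \<phi> F))"
    using dual unfolding is_dual_cyclic4_def combinatorially_dual_def by blast
  from someI_ex[OF this, folded dual_map_def]
  show "bij_betw dual_map {F. F face_of P} {G. G face_of cyclic_polytope4 n}"
    "F face_of P \<Longrightarrow> F' face_of P \<Longrightarrow> F \<subseteq> F' \<longleftrightarrow> dual_map F' \<subseteq> dual_map F"
    by blast+
qed

lemma dual_map_face: "F face_of P \<Longrightarrow> dual_map F face_of cyclic_polytope4 n"
  using bij_betwE[OF dual_map(1)] by blast

lemma dual_map_empty: "dual_map {} = cyclic_polytope4 n"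
proof -
  have "cyclic_polytope4 n \<in> dual_map ` {F. F face_of P}"
    using bij_betw_imp_surj_on[OF dual_map(1)] face_of_refl[OF convex_cyclic] by blast
  then obtain F where "F face_of P" "dual_map F = cyclic_polytope4 n" by auto
  then have "cyclic_polytope4 n \<subseteq> dual_map {}"
    using dual_map(2)[of "{}" F] empty_face_of by auto
  then show ?thesis using dual_map_face[of "{}"] face_of_imp_subset empty_face_of by blast
qed

text \<open>Facets of \<open>P\<close> correspond to the vertices of the cyclic polytope and so are
  numbered by indices; the label of a face is the set of facets that contain it.\<close>

definition label :: "(real ^ 4) set \<Rightarrow> nat set" where
  "label F = face_indices n (dual_map F)"

lemma label_subset_iff: "F face_of P \<Longrightarrow> G face_of P \<Longrightarrow> label G \<subseteq> label F \<longleftrightarrow> F \<subseteq> G"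
  unfolding label_def using dual_map(2) cyclic_face_subset_iff dual_map_face by metis

lemma label_in_complex:
  assumes "F face_of P" "F \<noteq> {}"
  shows "label F \<in> gale_complex n"
proof -
  have "dual_map F \<noteq> cyclic_polytope4 n"
    using assms dual_map(2)[OF assms(1), of "{}"] dual_map_empty
    by (metis empty_face_of order_refl subset_empty)
  then show ?thesis unfolding label_def
    using cyclic_face_indices_in_complex[OF n_ge dual_map_face[OF assms(1)]] by blast
qed

lemma ex_face_label:
  assumes "S \<in> gale_complex n"
  shows "\<exists>F. F face_of P \<and> F \<noteq> {} \<and> label F = S"
proof -
  obtain G where G: "G face_of cyclic_polytope4 n" "G \<noteq> cyclic_polytope4 n" "face_indices n G = S"
    using cyclic_complex_face[OF n_ge assms] by blast
  then obtain F where "F face_of P" "dual_map F = G"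
    using bij_betw_imp_surj_on[OF dual_map(1)] by (metis (mono_tags, lifting) imageE mem_Collect_eq)
  then show ?thesis using G dual_map_empty unfolding label_def by metis
qed

definition face :: "nat set \<Rightarrow> (real ^ 4) set" where
  "face S = (SOME F. F face_of P \<and> F \<noteq> {} \<and> label F = S)"

lemma face:
  assumes "S \<in> gale_complex n"
  shows "face S face_of P" "face S \<noteq> {}" "label (face S) = S"
  using someI_ex[OF ex_face_label[OF assms]] unfolding face_def by blast+

lemma face_label: "F face_of P \<Longrightarrow> F \<noteq> {} \<Longrightarrow> face (label F) = F"
proof -
  assume F: "F face_of P" "F \<noteq> {}"
  note l = face[OF label_in_complex[OF F]]
  show "face (label F) = F"
    using label_subset_iff[OF l(1) F(1)] label_subset_iff[OF F(1) l(1)] l(3) by auto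
qed

lemma face_subset_iff:
  "S \<in> gale_complex n \<Longrightarrow> T \<in> gale_complex n \<Longrightarrow> face S \<subseteq> face T \<longleftrightarrow> T \<subseteq> S"
  using label_subset_iff[of "face S" "face T"] face by simp

lemma face_eq_iff:
  "S \<in> gale_complex n \<Longrightarrow> T \<in> gale_complex n \<Longrightarrow> face S = face T \<longleftrightarrow> S = T"
  using face(3) by metis

lemma empty_in_complex: "{} \<in> gale_complex n"
  using label_in_complex[OF face_of_refl[OF polytope_imp_convex[OF polytope_P]] P_nonempty]
  by (rule gale_complex_subset) simp

lemma face_empty: "face {} = P"
proof -
  have P: "P face_of P" using face_of_refl polytope_imp_convex polytope_P by blast
  then have "P \<subseteq> face {}"
    using face_subset_iff[OF label_in_complex[OF P P_nonempty] empty_in_complex]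
    by (simp add: face_label P_nonempty)
  then show ?thesis using face(1)[OF empty_in_complex] face_of_imp_subset by blast
qed

lemma convex_face: "S \<in> gale_complex n \<Longrightarrow> convex (face S)"
  using face(1) face_of_imp_convex by blast

lemma polytope_face: "S \<in> gale_complex n \<Longrightarrow> polytope (face S)"
  using face(1) face_of_polytope_polytope polytope_P by blast

lemma face_face_of:
  "S \<in> gale_complex n \<Longrightarrow> T \<in> gale_complex n \<Longrightarrow> S \<subseteq> T \<Longrightarrow> face T face_of face S"
  using face_of_face face face_subset_iff by metis

lemma aff_dim_face_less:
  assumes "T \<in> gale_complex n" "S \<subset> T"
  shows "aff_dim (face T) < aff_dim (face S)"
proof -
  have S: "S \<in> gale_complex n" using assms gale_complex_subset by blast
  show ?thesis
    using face_of_aff_dim_lt[OF convex_face[OF S] face_face_of[OF S assms(1)]] assms face_eq_iff[OF S assms(1)]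
    by blast
qed

lemma aff_dim_face_drop:
  assumes "T \<in> gale_complex n" "S \<subseteq> T"
  shows "aff_dim (face T) + int (card (T - S)) \<le> aff_dim (face S)"
proof -
  have "finite (T - S)" using gale_complex_finite[OF assms(1)] by simp
  moreover have "aff_dim (face (S \<union> R)) + int (card R) \<le> aff_dim (face S)" if "finite R" "R \<subseteq> T - S" for R
    using that
  proof (induction R)
    case (insert i R)
    have "insert i (S \<union> R) \<subseteq> T" using insert.prems assms(2) by blast
    then have "insert i (S \<union> R) \<in> gale_complex n" by (rule gale_complex_subset[OF assms(1)])
    then have "aff_dim (face (insert i (S \<union> R))) < aff_dim (face (S \<union> R))"
      by (rule aff_dim_face_less) (use insert in auto)
    then show ?case using insert by simp
  qed simp
  ultimately have "aff_dim (face (S \<union> (T - S))) + int (card (T - S)) \<le> aff_dim (face S)" by blast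
  moreover have "S \<union> (T - S) = T" using assms by blast
  ultimately show ?thesis by simp
qed

text \<open>Each added label passes to a proper face and costs at least one dimension. Four labels
  lead from dimension 4 to a nonempty face, so each step costs exactly one. This extracts dimensions
  from the bare face lattice.\<close>

lemma aff_dim_face:
  assumes "S \<in> gale_complex n"
  shows "aff_dim (face S) = 4 - int (card S)"
proof (rule antisym)
  show "aff_dim (face S) \<le> 4 - int (card S)"
    using aff_dim_face_drop[OF assms, of "{}"] by (simp add: face_empty aff_dim_P)
  obtain p where p: "p \<in> verts n" "S \<subseteq> gale n p" using assms by (auto simp: gale_complex_def)
  note g = gale_in_complex[OF p(1)]
  have "aff_dim (face (gale n p)) \<ge> 0"
    using face(2)[OF g] aff_dim_empty[of "face (gale n p)"] aff_dim_geq[of "face (gale n p)"] by linarith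
  moreover have "card (gale n p - S) = 4 - card S" "card S \<le> 4"
    using p card_Diff_subset[of S "gale n p"] card_gale[OF p(1)] gale_complex_finite[OF assms]
      gale_complex_card[OF assms] by auto
  ultimately show "4 - int (card S) \<le> aff_dim (face S)"
    using aff_dim_face_drop[OF g p(2)] by simp
qed

lemma facet_of_face_iff:
  assumes "S \<in> gale_complex n"
  shows "H facet_of face S \<longleftrightarrow> (\<exists>i. i \<notin> S \<and> insert i S \<in> gale_complex n \<and> H = face (insert i S))"
proof
  assume H: "H facet_of face S"
  then have Hf: "H face_of face S" "H \<noteq> {}" "aff_dim H = aff_dim (face S) - 1"
    by (auto simp: facet_of_def)
  have HP: "H face_of P" using Hf(1) face(1)[OF assms] face_of_trans by blast
  define T where "T = label H"
  have T: "T \<in> gale_complex n" "H = face T"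
    using label_in_complex[OF HP Hf(2)] face_label[OF HP Hf(2)] by (auto simp: T_def)
  have "S \<subseteq> T" using face_of_imp_subset[OF Hf(1)] face_subset_iff[OF T(1) assms] T(2) by blast
  moreover have "card T = Suc (card S)" using Hf(3) aff_dim_face[OF assms] aff_dim_face[OF T(1)] T(2) by simp
  ultimately have "card (T - S) = 1" using gale_complex_finite[OF assms] by (simp add: card_Diff_subset)
  then obtain i where "T - S = {i}" by (rule card_1_singletonE)
  with \<open>S \<subseteq> T\<close> have "i \<notin> S" "T = insert i S" by blast+
  then show "\<exists>i. i \<notin> S \<and> insert i S \<in> gale_complex n \<and> H = face (insert i S)" using T by blast
next
  assume "\<exists>i. i \<notin> S \<and> insert i S \<in> gale_complex n \<and> H = face (insert i S)"
  then obtain i where i: "i \<notin> S" "insert i S \<in> gale_complex n" "H = face (insert i S)" by blast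
  have "card (insert i S) = Suc (card S)" using i gale_complex_finite[OF assms] by simp
  then show "H facet_of face S"
    using face_face_of[OF assms i(2)] i face(2)[OF i(2)] aff_dim_face[OF assms] aff_dim_face[OF i(2)]
    by (auto simp: facet_of_def)
qed

section \<open>Vertices and edges of the dual polytope as label sets\<close>

definition vtx :: "nat \<times> nat \<Rightarrow> real ^ 4" where
  "vtx p = the_elem (face (gale n p))"

lemma face_gale: "p \<in> verts n \<Longrightarrow> face (gale n p) = {vtx p}"
proof -
  assume p: "p \<in> verts n"
  have "aff_dim (face (gale n p)) = 0" using aff_dim_face[OF gale_in_complex[OF p]] card_gale[OF p] by simp
  then obtain a where "face (gale n p) = {a}" unfolding aff_dim_eq_0 by blast
  then show "face (gale n p) = {vtx p}" by (simp add: vtx_def)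
qed

lemma vtx_mem_face_iff:
  "p \<in> verts n \<Longrightarrow> S \<in> gale_complex n \<Longrightarrow> vtx p \<in> face S \<longleftrightarrow> S \<subseteq> gale n p"
  using face_subset_iff[OF gale_in_complex, of p S] by (simp add: face_gale)

lemma vtx_eq_iff: "p \<in> verts n \<Longrightarrow> q \<in> verts n \<Longrightarrow> vtx p = vtx q \<longleftrightarrow> p = q"
  using face_eq_iff[OF gale_in_complex gale_in_complex, of p q] gale_inj[OF n_ge, of p q] by (auto simp: face_gale)

lemma extreme_point_iff: "v extreme_point_of P \<longleftrightarrow> (\<exists>p\<in>verts n. v = vtx p)"
proof
  assume "v extreme_point_of P"
  then have v: "{v} face_of P" by (simp add: face_of_singleton)
  have c: "label {v} \<in> gale_complex n" using label_in_complex[OF v] by simp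
  then obtain p where p: "p \<in> verts n" "label {v} \<subseteq> gale n p" by (auto simp: gale_complex_def)
  then have "vtx p \<in> face (label {v})" using vtx_mem_face_iff[OF p(1) c] by simp
  then have "vtx p = v" using face_label[OF v] by simp
  then show "\<exists>p\<in>verts n. v = vtx p" using p by blast
next
  assume "\<exists>p\<in>verts n. v = vtx p"
  then show "v extreme_point_of P" using face(1)[OF gale_in_complex] face_gale face_of_singleton by metis
qed

lemma extreme_point_face_iff:
  assumes "S \<in> gale_complex n"
  shows "v extreme_point_of face S \<longleftrightarrow> (\<exists>p\<in>verts n. v = vtx p \<and> S \<subseteq> gale n p)"
  unfolding extreme_point_of_face[OF face(1)[OF assms]] extreme_point_iff
  using vtx_mem_face_iff[OF _ assms] by blast

lemma edge_segment:
  assumes "S \<in> gale_complex n" "card S = 3"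
  obtains a b where "face S = closed_segment a b" "\<And>p. p \<in> verts n \<Longrightarrow> S \<subseteq> gale n p \<Longrightarrow> vtx p = a \<or> vtx p = b"
proof -
  have "collinear (face S)" using aff_dim_face[OF assms(1)] assms(2) by (simp add: collinear_aff_dim)
  then obtain a b where ab: "face S = closed_segment a b"
    using compact_convex_collinear_segment[OF face(2)[OF assms(1)]] polytope_imp_compact[OF polytope_face[OF assms(1)]]
      convex_face[OF assms(1)] by blast
  show ?thesis
    using that[OF ab] extreme_point_face_iff[OF assms(1)] unfolding ab extreme_point_of_segment by blast
qed

text \<open>A segment has only two extreme points. This geometric fact replaces a combinatorial case
  analysis of which Gale sets share three labels.\<close>

lemma edge_at_most_two:
  assumes "S \<in> gale_complex n" "card S = 3"
    and "p \<in> verts n" "q \<in> verts n" "r \<in> verts n" "S \<subseteq> gale n p" "S \<subseteq> gale n q" "S \<subseteq> gale n r"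
  shows "p = q \<or> q = r \<or> p = r"
proof -
  obtain a b where "\<And>p. p \<in> verts n \<Longrightarrow> S \<subseteq> gale n p \<Longrightarrow> vtx p = a \<or> vtx p = b"
    using edge_segment[OF assms(1,2)] by metis
  then have "vtx p = vtx q \<or> vtx q = vtx r \<or> vtx p = vtx r" using assms(3-8) by metis
  then show ?thesis using vtx_eq_iff assms by metis
qed

lemma card_gale_Int_le: "p \<in> verts n \<Longrightarrow> q \<in> verts n \<Longrightarrow> p \<noteq> q \<Longrightarrow> card (gale n p \<inter> gale n q) \<le> 3"
proof (rule ccontr)
  assume a: "p \<in> verts n" "q \<in> verts n" "p \<noteq> q" "\<not> card (gale n p \<inter> gale n q) \<le> 3"
  have "gale n p \<inter> gale n q = gale n p"
    by (rule card_seteq) (use a(4) card_gale[OF a(1)] in auto)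
  moreover have "gale n p \<inter> gale n q = gale n q"
    by (rule card_seteq) (use a(4) card_gale[OF a(2)] in auto)
  ultimately show False using gale_inj[OF n_ge a(1,2)] a(3) by metis
qed

lemma adjacent_iff:
  assumes "p \<in> verts n" "q \<in> verts n"
  shows "adjacent P (vtx p) (vtx q) \<longleftrightarrow> card (gale n p \<inter> gale n q) = 3"
proof
  assume "adjacent P (vtx p) (vtx q)"
  then have e: "closed_segment (vtx p) (vtx q) face_of P" "aff_dim (closed_segment (vtx p) (vtx q)) = 1"
    unfolding adjacent_def edge_of_def by blast+
  then have pq: "p \<noteq> q" by auto
  define T where "T = label (closed_segment (vtx p) (vtx q))"
  have T: "T \<in> gale_complex n" "face T = closed_segment (vtx p) (vtx q)"
    using label_in_complex[OF e(1)] face_label[OF e(1)] by (auto simp: T_def)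
  then have "card T = 3" using aff_dim_face e(2) by force
  moreover have "T \<subseteq> gale n p \<inter> gale n q"
    using vtx_mem_face_iff[OF assms(1) T(1)] vtx_mem_face_iff[OF assms(2) T(1)] T(2) by simp
  then have "card T \<le> card (gale n p \<inter> gale n q)" by (intro card_mono) auto
  ultimately show "card (gale n p \<inter> gale n q) = 3" using card_gale_Int_le[OF assms pq] by simp
next
  assume c: "card (gale n p \<inter> gale n q) = 3"
  then have pq: "p \<noteq> q" using card_gale[OF assms(1)] by auto
  define S where "S = gale n p \<inter> gale n q"
  have S: "S \<in> gale_complex n" using assms(1) by (auto simp: S_def gale_complex_def)
  obtain a b where ab: "face S = closed_segment a b" "vtx p = a \<or> vtx p = b" "vtx q = a \<or> vtx q = b"
    using edge_segment[OF S] c assms unfolding S_def by (metis Int_lower1 Int_lower2)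
  then have "face S = closed_segment (vtx p) (vtx q)"
    using vtx_eq_iff[OF assms] pq closed_segment_commute by metis
  then have "closed_segment (vtx p) (vtx q) edge_of P"
    using face(1)[OF S] aff_dim_face[OF S] c by (auto simp: edge_of_def S_def)
  then show "adjacent P (vtx p) (vtx q)" using assms extreme_point_iff by (auto simp: adjacent_def)
qed

subsection \<open>The orientation\<close>

lemma card_gale_Int_flip:
  assumes "p \<in> verts n" "i \<in> gale n p"
  shows "gale n p \<inter> gale n (flip n p i) = gale n p - {i}" "card (gale n p \<inter> gale n (flip n p i)) = 3"
proof -
  show e: "gale n p \<inter> gale n (flip n p i) = gale n p - {i}" using flip[OF n_ge assms] by blast
  show "card (gale n p \<inter> gale n (flip n p i)) = 3" unfolding e using assms by (simp add: card_gale)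
qed

text \<open>The three common labels belong to \<open>p\<close>, to \<open>q\<close> and to the flip
  of \<open>p\<close>, and an edge has no third vertex.\<close>

lemma adjacent_flip:
  assumes p: "p \<in> verts n" and q: "q \<in> verts n" and c: "card (gale n p \<inter> gale n q) = 3"
  shows "\<exists>i\<in>gale n p. q = flip n p i"
proof -
  have "card (gale n p - gale n q) = 1"
    using c card_gale[OF p] by (simp add: card_Diff_subset_Int)
  then obtain i where i: "gale n p - gale n q = {i}" by (rule card_1_singletonE)
  then have ip: "i \<in> gale n p" "i \<notin> gale n q" by blast+
  define S where "S = gale n p - {i}"
  have S: "S \<in> gale_complex n" "card S = 3" "S \<subseteq> gale n p" "S \<subseteq> gale n q" "S \<subseteq> gale n (flip n p i)"
    using p ip i flip(2)[OF n_ge p ip(1)] gale_in_complex[OF p] gale_complex_subset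
    by (auto simp: S_def card_gale)
  have "p = q \<or> q = flip n p i \<or> p = flip n p i"
    using edge_at_most_two[OF S(1,2) p q flip(1)[OF n_ge p ip(1)] S(3-5)] .
  then show ?thesis using ip flip(3)[OF n_ge p ip(1)] by auto
qed

text \<open>Defined from \<open>outs\<close> so that out-neighbours in a face can be computed; the
  description by the potential, from which acyclicity follows, is \<open>orient_iff\<close>.\<close>

definition orient :: "((real ^ 4) \<times> (real ^ 4)) set" where
  "orient = {(vtx p, vtx (flip n p i)) |p i. p \<in> verts n \<and> i \<in> outs n p}"

lemma orientI: "p \<in> verts n \<Longrightarrow> i \<in> outs n p \<Longrightarrow> (vtx p, vtx (flip n p i)) \<in> orient"
  unfolding orient_def by blast

lemma orient_iff:
  assumes p: "p \<in> verts n" and q: "q \<in> verts n"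
  shows "(vtx p, vtx q) \<in> orient \<longleftrightarrow> card (gale n p \<inter> gale n q) = 3 \<and> pot n p < pot n q"
proof
  assume "(vtx p, vtx q) \<in> orient"
  then obtain p' i where i: "p' \<in> verts n" "i \<in> outs n p'" "vtx p = vtx p'" "vtx q = vtx (flip n p' i)"
    by (auto simp: orient_def)
  then have e: "p' = p" "i \<in> gale n p" using vtx_eq_iff[OF p] outs_subset[OF p] by auto
  then have "q = flip n p i" using i vtx_eq_iff[OF q] flip(1)[OF n_ge p] by auto
  then show "card (gale n p \<inter> gale n q) = 3 \<and> pot n p < pot n q"
    using card_gale_Int_flip[OF p e(2)] pot_flip(1)[OF n_ge p e(2)] i e by simp
next
  assume a: "card (gale n p \<inter> gale n q) = 3 \<and> pot n p < pot n q"
  then obtain i where i: "i \<in> gale n p" "q = flip n p i" using adjacent_flip[OF p q] by blast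
  then have "i \<in> outs n p" using pot_flip(1)[OF n_ge p] a by simp
  then show "(vtx p, vtx q) \<in> orient" using orientI[OF p] i(2) by simp
qed

lemma orient_vtx: "(v, w) \<in> orient \<Longrightarrow> \<exists>p\<in>verts n. \<exists>q\<in>verts n. v = vtx p \<and> w = vtx q"
  unfolding orient_def using flip(1)[OF n_ge] outs_subset by blast

lemma is_orientation_orient: "is_orientation P orient"
  unfolding is_orientation_def
proof (intro conjI allI impI)
  fix v w assume a: "(v, w) \<in> orient"
  then obtain p q where pq: "p \<in> verts n" "q \<in> verts n" "v = vtx p" "w = vtx q" using orient_vtx by blast
  then show "adjacent P v w" using a orient_iff[OF pq(1,2)] adjacent_iff[OF pq(1,2)] by simp
next
  fix v w assume a: "adjacent P v w"
  then obtain p q where pq: "p \<in> verts n" "q \<in> verts n" "v = vtx p" "w = vtx q"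
    using extreme_point_iff unfolding adjacent_def by metis
  then have c: "card (gale n p \<inter> gale n q) = 3" using a adjacent_iff by simp
  obtain i where "i \<in> gale n p" "q = flip n p i" using adjacent_flip[OF pq(1,2) c] by blast
  then have "pot n p \<noteq> pot n q" using pot_flip(2)[OF n_ge pq(1)] by simp
  then show "((v, w) \<in> orient) = ((w, v) \<notin> orient)"
    using orient_iff[OF pq(1,2)] orient_iff[OF pq(2,1)] c pq by (auto simp: Int_commute)
qed

lemma acyclic_orient: "acyclic orient"
proof (rule acyclicI_order)
  fix v w assume a: "(v, w) \<in> orient"
  obtain p q where pq: "p \<in> verts n" "q \<in> verts n" "v = vtx p" "w = vtx q" using orient_vtx[OF a] by blast
  \<comment> \<open>The order criterion for acyclicity asks for a function on the points of the
    space that decreases along edges, hence the inverse of \<open>vtx\<close> and the negated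
    potential.\<close>
  have inv: "inv_into (verts n) vtx (vtx p) = p" if "p \<in> verts n" for p
    using that vtx_eq_iff by (intro inv_into_f_f inj_onI) auto
  show "- int (pot n (inv_into (verts n) vtx w)) < - int (pot n (inv_into (verts n) vtx v))"
    using a orient_iff[OF pq(1,2)] pq inv by simp
qed

lemma out_nbrs_face:
  assumes p: "p \<in> verts n" and S: "S \<subseteq> gale n p"
  shows "out_nbrs orient (face S) (vtx p) = (\<lambda>i. vtx (flip n p i)) ` (outs n p - S)"
proof -
  have Sc: "S \<in> gale_complex n" using p S by (auto simp: gale_complex_def)
  have mem: "vtx (flip n p i) \<in> face S \<longleftrightarrow> i \<notin> S" if "i \<in> gale n p" for i
    using vtx_mem_face_iff[OF flip(1)[OF n_ge p that] Sc] flip(2,3)[OF n_ge p that] S by auto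
  have "(vtx p, w) \<in> orient \<longleftrightarrow> (\<exists>i\<in>outs n p. w = vtx (flip n p i))" for w
  proof
    assume "(vtx p, w) \<in> orient"
    then obtain p' i where "p' \<in> verts n" "i \<in> outs n p'" "vtx p = vtx p'" "w = vtx (flip n p' i)"
      by (auto simp: orient_def)
    then show "\<exists>i\<in>outs n p. w = vtx (flip n p i)" using vtx_eq_iff[OF p] by auto
  qed (use orientI[OF p] in blast)
  then show ?thesis unfolding out_nbrs_def using mem outs_subset[OF p] by auto
qed

lemma inj_on_flip:
  assumes p: "p \<in> verts n"
  shows "inj_on (\<lambda>i. vtx (flip n p i)) (outs n p - S)"
proof (rule inj_onI)
  fix i j assume i: "i \<in> outs n p - S" and j: "j \<in> outs n p - S"
    and e: "vtx (flip n p i) = vtx (flip n p j)"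
  have ip: "i \<in> gale n p" "j \<in> gale n p" using i j outs_subset[OF p] by auto
  have "flip n p i = flip n p j"
    using e vtx_eq_iff[OF flip(1)[OF n_ge p ip(1)] flip(1)[OF n_ge p ip(2)]] by simp
  then show "i = j" using flip(2,3)[OF n_ge p ip(1)] flip(2,3)[OF n_ge p ip(2)] ip by auto
qed

lemma card_out_nbrs_face:
  assumes p: "p \<in> verts n" and S: "S \<subseteq> gale n p"
  shows "card (out_nbrs orient (face S) (vtx p)) = card (outs n p - S)"
  unfolding out_nbrs_face[OF assms] by (rule card_image[OF inj_on_flip[OF p]])

section \<open>Sinks of faces\<close>

lemma is_sink_iff:
  assumes S: "S \<in> gale_complex n"
  shows "is_sink orient (face S) v \<longleftrightarrow> (\<exists>p\<in>verts n. v = vtx p \<and> S \<subseteq> gale n p \<and> outs n p \<subseteq> S)"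
proof -
  have "is_sink orient (face S) v \<longleftrightarrow> v extreme_point_of face S \<and> out_nbrs orient (face S) v = {}"
    by (auto simp: is_sink_def out_nbrs_def)
  also have "\<dots> \<longleftrightarrow> (\<exists>p\<in>verts n. v = vtx p \<and> S \<subseteq> gale n p \<and> out_nbrs orient (face S) (vtx p) = {})"
    unfolding extreme_point_face_iff[OF S] by blast
  also have "\<dots> \<longleftrightarrow> (\<exists>p\<in>verts n. v = vtx p \<and> S \<subseteq> gale n p \<and> outs n p \<subseteq> S)"
    using out_nbrs_face by (intro bex_cong refl) (metis Diff_eq_empty_iff image_is_empty)
  finally show ?thesis .
qed

lemma max_pot_outs:
  assumes p: "p \<in> verts n" and S: "S \<subseteq> gale n p"
    and max: "\<And>q. q \<in> verts n \<Longrightarrow> S \<subseteq> gale n q \<Longrightarrow> pot n q \<le> pot n p"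
  shows "outs n p \<subseteq> S"
proof (rule ccontr)
  assume "\<not> outs n p \<subseteq> S"
  then obtain i where i: "i \<in> outs n p" "i \<notin> S" by blast
  then have ip: "i \<in> gale n p" using outs_subset[OF p] by blast
  have "S \<subseteq> gale n (flip n p i)" using flip(2)[OF n_ge p ip] i(2) S by blast
  then show False using max[OF flip(1)[OF n_ge p ip]] pot_flip(1)[OF n_ge p ip] i(1) by simp
qed

lemma ex_max_pot:
  assumes S: "S \<in> gale_complex n"
  shows "\<exists>p\<in>verts n. S \<subseteq> gale n p \<and> (\<forall>q\<in>verts n. S \<subseteq> gale n q \<longrightarrow> pot n q \<le> pot n p)"
proof -
  define Q where "Q = {p \<in> verts n. S \<subseteq> gale n p}"
  have Q: "finite Q" "Q \<noteq> {}" using S finite_verts by (auto simp: Q_def gale_complex_def)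
  then have "Max (pot n ` Q) \<in> pot n ` Q" by (intro Max_in) auto
  then obtain p where p: "p \<in> Q" "pot n p = Max (pot n ` Q)" by auto
  have "pot n q \<le> pot n p" if "q \<in> Q" for q using p Q that by simp
  then show ?thesis using p by (auto simp: Q_def)
qed

definition sink :: "nat set \<Rightarrow> nat \<times> nat" where
  "sink S = (THE p. p \<in> verts n \<and> S \<subseteq> gale n p \<and> outs n p \<subseteq> S)"

lemma sink_unique:
  "p \<in> verts n \<Longrightarrow> S \<subseteq> gale n p \<Longrightarrow> outs n p \<subseteq> S \<Longrightarrow>
   q \<in> verts n \<Longrightarrow> S \<subseteq> gale n q \<Longrightarrow> outs n q \<subseteq> S \<Longrightarrow> p = q"
  by (rule outs_unique[OF n_ge]) (assumption | rule subset_trans)+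

lemma sink_eq: "p \<in> verts n \<Longrightarrow> S \<subseteq> gale n p \<Longrightarrow> outs n p \<subseteq> S \<Longrightarrow> sink S = p"
  unfolding sink_def by (rule the_equality) (auto intro: sink_unique)

lemma sink:
  assumes "S \<in> gale_complex n"
  shows "sink S \<in> verts n" "S \<subseteq> gale n (sink S)" "outs n (sink S) \<subseteq> S"
proof -
  obtain p where p: "p \<in> verts n" "S \<subseteq> gale n p" "\<forall>q\<in>verts n. S \<subseteq> gale n q \<longrightarrow> pot n q \<le> pot n p"
    using ex_max_pot[OF assms] by blast
  have o: "outs n p \<subseteq> S" using max_pot_outs[OF p(1,2)] p(3) by blast
  show "sink S \<in> verts n" "S \<subseteq> gale n (sink S)" "outs n (sink S) \<subseteq> S"
    unfolding sink_eq[OF p(1,2) o] using p(1,2) o by blast+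
qed

text \<open>A maximum of the potential on a face is a sink, and sinks are unique, so the sink is the
  maximum. This is the progress made by solving a facet recursively.\<close>

lemma pot_less_sink:
  assumes p: "p \<in> verts n" "S \<subseteq> gale n p" and o: "\<not> outs n p \<subseteq> S"
  shows "pot n p < pot n (sink S)"
proof (rule ccontr)
  assume l: "\<not> pot n p < pot n (sink S)"
  have S: "S \<in> gale_complex n" using p by (auto simp: gale_complex_def)
  obtain q where q: "q \<in> verts n" "S \<subseteq> gale n q" "\<forall>r\<in>verts n. S \<subseteq> gale n r \<longrightarrow> pot n r \<le> pot n q"
    using ex_max_pot[OF S] by blast
  have "sink S = q" using sink_eq[OF q(1,2)] max_pot_outs[OF q(1,2)] q(3) by blast
  then have "pot n r \<le> pot n p" if "r \<in> verts n" "S \<subseteq> gale n r" for r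
    using l q(3) that by force
  then show False using max_pot_outs[OF p] o by blast
qed

lemma AUSO_orient: "AUSO P orient"
  unfolding AUSO_def
proof (intro conjI is_orientation_orient acyclic_orient allI impI)
  fix F assume F: "F face_of P \<and> F \<noteq> {}"
  define S where "S = label F"
  have S: "S \<in> gale_complex n" "F = face S"
    using F label_in_complex face_label by (auto simp: S_def)
  show "\<exists>!v. is_sink orient F v"
    unfolding S(2) is_sink_iff[OF S(1)]
  proof (rule ex1I[of _ "vtx (sink S)"])
    show "\<exists>p\<in>verts n. vtx (sink S) = vtx p \<and> S \<subseteq> gale n p \<and> outs n p \<subseteq> S"
      using sink[OF S(1)] by blast
  next
    fix v assume "\<exists>p\<in>verts n. v = vtx p \<and> S \<subseteq> gale n p \<and> outs n p \<subseteq> S"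
    then show "v = vtx (sink S)" using sink_eq by metis
  qed
qed

section \<open>The global source\<close>

definition source :: "nat \<times> nat" where
  "source = (n - 3, n - 1)"

lemma source_verts: "source \<in> verts n"
  using n_ge by (auto simp: source_def verts_def)

lemma source_high: "\<not> low n source"
  using n_ge by (auto simp: source_def low_def)

lemma outs_source: "outs n source = gale n source"
  using n_ge source_high by (auto simp: source_def outs_def gale_def)

lemma outs_eq_gale_imp:
  assumes p: "p \<in> verts n" and o: "gale n p \<subseteq> outs n p"
  shows "p = source"
proof -
  obtain x y where xy: "p = (x, y)" by (cases p)
  have d: "x + 2 \<le> y" "y < n" using p by (auto simp: xy verts_def)
  have m: "x \<in> outs n (x, y)" "Suc x \<in> outs n (x, y)" using o by (auto simp: xy gale_def)
  have "\<not> low n (x, y)" using m(2) d by (auto simp: outs_def)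
  then have "y = x + 2 \<and> Suc y = n" using m(1) d p[unfolded xy verts_def] by (auto simp: outs_def split: if_splits)
  then show ?thesis by (auto simp: xy source_def)
qed

lemma is_source_iff: "is_source orient P v \<longleftrightarrow> v = vtx source"
proof
  assume v: "is_source orient P v"
  then obtain p where p: "p \<in> verts n" "v = vtx p" using extreme_point_iff by (auto simp: is_source_def)
  have "i \<in> outs n p" if i: "i \<in> gale n p" for i
  proof (rule ccontr)
    assume no: "i \<notin> outs n p"
    note f = flip(1)[OF n_ge p(1) i]
    have "pot n (flip n p i) < pot n p" using no pot_flip[OF n_ge p(1) i] by simp
    then have "(vtx (flip n p i), v) \<in> orient"
      using orient_iff[OF f p(1)] card_gale_Int_flip(2)[OF p(1) i] p(2) by (simp add: Int_commute)
    moreover have "vtx (flip n p i) \<in> P" using extreme_point_iff f by (auto simp: extreme_point_of_def)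
    ultimately show False using v by (auto simp: is_source_def)
  qed
  then show "v = vtx source" using outs_eq_gale_imp[OF p(1)] p(2) by blast
next
  assume v: "v = vtx source"
  have "(w, vtx source) \<notin> orient" for w
  proof
    assume a: "(w, vtx source) \<in> orient"
    then obtain q where q: "q \<in> verts n" "w = vtx q" using orient_vtx by blast
    have c: "card (gale n q \<inter> gale n source) = 3" "pot n q < pot n source"
      using a orient_iff[OF q(1) source_verts] q(2) by auto
    then obtain i where i: "i \<in> gale n source" "q = flip n source i"
      using adjacent_flip[OF source_verts q(1)] by (auto simp: Int_commute)
    then show False using pot_flip(1)[OF n_ge source_verts i(1)] c(2) outs_source by simp
  qed
  then show "is_source orient P v" using source_verts extreme_point_iff by (auto simp: is_source_def v)
qed

lemma global_source_source: "global_source P orient (vtx source)"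
  by (simp add: global_source_def is_source_iff)

subsection \<open>Termination and the recursion for the expected cost\<close>

lemma facets_through:
  assumes p: "p \<in> verts n" and S: "S \<subseteq> gale n p"
  shows "{G. G facet_of face S \<and> vtx p \<in> G} = (\<lambda>i. face (insert i S)) ` (gale n p - S)"
proof -
  have Sc: "S \<in> gale_complex n" using assms by (auto simp: gale_complex_def)
  have "insert i S \<in> gale_complex n" if "i \<in> gale n p" for i using that assms by (auto simp: gale_complex_def)
  then show ?thesis unfolding facet_of_face_iff[OF Sc] using vtx_mem_face_iff[OF p] S by blast
qed

lemma inj_on_facets:
  assumes p: "p \<in> verts n" and S: "S \<subseteq> gale n p"
  shows "inj_on (\<lambda>i. face (insert i S)) (gale n p - S)"
proof (rule inj_onI)
  fix i j assume i: "i \<in> gale n p - S" and j: "j \<in> gale n p - S" and e: "face (insert i S) = face (insert j S)"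
  have "insert i S \<in> gale_complex n" "insert j S \<in> gale_complex n"
    using i j assms by (auto simp: gale_complex_def)
  then have "insert i S = insert j S" using e face_eq_iff by simp
  then show "i = j" using i j by blast
qed

text \<open>Losslessness allows costs to be added under the integral, the certain endpoint reduces
  the recursion to sinks of facets, and finite support makes the expectation a genuine
  integral.\<close>

lemma random_facet_reaches_sink:
  assumes "p \<in> verts n" "S \<subseteq> gale n p"
  shows "lossless_spmf (random_facet orient (face S) (vtx p)) \<and>
    finite (set_spmf (random_facet orient (face S) (vtx p))) \<and>
    fst ` set_spmf (random_facet orient (face S) (vtx p)) \<subseteq> {vtx (sink S)}"
  using assms
\<comment> \<open>A lexicographic measure: a call either raises the potential or keeps the vertex
  and descends to a facet. The second summand is at most 4, hence the factor 5.\<close>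
proof (induction "5 * (Max (pot n ` verts n) - pot n p) + (4 - card S)" arbitrary: p S rule: less_induct)
  case less
  note p = less.prems(1) and S = less.prems(2)
  have pot_le: "pot n q \<le> Max (pot n ` verts n)" if "q \<in> verts n" for q
    using that finite_verts by simp
  have card_S: "card S \<le> 4" using card_mono[OF finite_gale S] card_gale[OF p] by simp
  have fin: "finite S" using S finite_subset finite_gale by blast
  let ?N = "out_nbrs orient (face S) (vtx p)"
  consider "?N = {}" | "card ?N = 1" | "?N \<noteq> {}" "card ?N \<noteq> 1" by blast
  then show ?case
  proof cases
    case 1
    then have "outs n p \<subseteq> S" using out_nbrs_face[OF p S] by auto
    then have "sink S = p" using sink_eq[OF p S] by simp
    then show ?thesis unfolding random_facet_sink[OF 1] by simp
  next
    case 2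
    then obtain i where i: "outs n p - S = {i}" using card_out_nbrs_face[OF p S] by (metis card_1_singletonE)
    then have ip: "i \<in> gale n p" "i \<in> outs n p" using outs_subset[OF p] by blast+
    let ?q = "flip n p i"
    have q: "?q \<in> verts n" "S \<subseteq> gale n ?q" "pot n p < pot n ?q"
      using flip(1,2)[OF n_ge p ip(1)] pot_flip(1)[OF n_ge p ip(1)] ip i S by auto
    have N: "?N = {vtx ?q}" unfolding out_nbrs_face[OF p S] i by simp
    have "5 * (Max (pot n ` verts n) - pot n ?q) + (4 - card S) < 5 * (Max (pot n ` verts n) - pot n p) + (4 - card S)"
      using q(3) pot_le[OF q(1)] by simp
    from less.hyps[OF this q(1,2)] show ?thesis
      unfolding random_facet_forced[OF N] by (auto simp: set_bind_spmf bind_UNION split_beta)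
  next
    case 3
    \<comment> \<open>Of at least two outgoing directions, a facet of the current face cuts off at
      most one.\<close>
    have N: "\<not> outs n p \<subseteq> insert i S" if "i \<notin> S" for i
    proof
      assume "outs n p \<subseteq> insert i S"
      then have "outs n p - S \<subseteq> {i}" by blast
      then have "outs n p - S = {} \<or> outs n p - S = {i}" by blast
      then show False using 3 out_nbrs_face[OF p S] card_out_nbrs_face[OF p S] by auto
    qed
    have step: "lossless_spmf (random_facet orient (face (insert i S)) (vtx p)) \<and>
        finite (set_spmf (random_facet orient (face (insert i S)) (vtx p))) \<and>
        fst ` set_spmf (random_facet orient (face (insert i S)) (vtx p)) \<subseteq> {vtx (sink (insert i S))}"
      "lossless_spmf (random_facet orient (face S) (vtx (sink (insert i S)))) \<and>
        finite (set_spmf (random_facet orient (face S) (vtx (sink (insert i S))))) \<and>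
        fst ` set_spmf (random_facet orient (face S) (vtx (sink (insert i S)))) \<subseteq> {vtx (sink S)}"
      if i: "i \<in> gale n p - S" for i
    proof -
      have iS: "insert i S \<subseteq> gale n p" using i S by blast
      have "card (insert i S) \<le> 4" using card_mono[OF finite_gale iS] card_gale[OF p] by simp
      then have "5 * (Max (pot n ` verts n) - pot n p) + (4 - card (insert i S))
          < 5 * (Max (pot n ` verts n) - pot n p) + (4 - card S)"
        using i fin by simp
      from less.hyps[OF this p iS]
      show "lossless_spmf (random_facet orient (face (insert i S)) (vtx p)) \<and>
        finite (set_spmf (random_facet orient (face (insert i S)) (vtx p))) \<and>
        fst ` set_spmf (random_facet orient (face (insert i S)) (vtx p)) \<subseteq> {vtx (sink (insert i S))}" .
      have iSc: "insert i S \<in> gale_complex n" using iS p by (auto simp: gale_complex_def)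
      note s = sink[OF iSc]
      have "pot n p < pot n (sink (insert i S))" using pot_less_sink[OF p iS] N i by blast
      then have "5 * (Max (pot n ` verts n) - pot n (sink (insert i S))) + (4 - card S)
          < 5 * (Max (pot n ` verts n) - pot n p) + (4 - card S)"
        using pot_le[OF s(1)] by simp
      from less.hyps[OF this s(1)] s(2)
      show "lossless_spmf (random_facet orient (face S) (vtx (sink (insert i S)))) \<and>
        finite (set_spmf (random_facet orient (face S) (vtx (sink (insert i S))))) \<and>
        fst ` set_spmf (random_facet orient (face S) (vtx (sink (insert i S)))) \<subseteq> {vtx (sink S)}"
        by blast
    qed
    have ne: "gale n p - S \<noteq> {}"
    proof
      assume "gale n p - S = {}"
      then have "outs n p - S = {}" using outs_subset[OF p] by blast
      then show False using 3(1) out_nbrs_face[OF p S] by simp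
    qed
    have mem: "fst x = vtx (sink (insert i S))"
      if "i \<in> gale n p - S" "x \<in> set_spmf (random_facet orient (face (insert i S)) (vtx p))" for i x
      using step(1)[OF that(1)] that(2) by blast
    have inner: "lossless_spmf (bind_spmf (random_facet orient (face S) (fst x)) (\<lambda>(u, m). return_spmf (u, snd x + m))) \<and>
        finite (set_spmf (bind_spmf (random_facet orient (face S) (fst x)) (\<lambda>(u, m). return_spmf (u, snd x + m)))) \<and>
        fst ` set_spmf (bind_spmf (random_facet orient (face S) (fst x)) (\<lambda>(u, m). return_spmf (u, snd x + m)))
          \<subseteq> {vtx (sink S)}"
      if "i \<in> gale n p - S" "x \<in> set_spmf (random_facet orient (face (insert i S)) (vtx p))" for i x
      unfolding mem[OF that] using step(2)[OF that(1)] by (intro terminating_bind) auto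
    show ?thesis
      unfolding random_facet_choose[OF 3] facets_through[OF p S]
    proof (rule terminating_bind)
      show "lossless_spmf (spmf_of_set ((\<lambda>i. face (insert i S)) ` (gale n p - S))) \<and>
        finite (set_spmf (spmf_of_set ((\<lambda>i. face (insert i S)) ` (gale n p - S))))"
        using ne by simp
    next
      fix G assume "G \<in> set_spmf (spmf_of_set ((\<lambda>i. face (insert i S)) ` (gale n p - S)))"
      then obtain i where i: "i \<in> gale n p - S" "G = face (insert i S)" by auto
      show "lossless_spmf (random_facet orient G (vtx p) \<bind> (\<lambda>(w, l).
            random_facet orient (face S) w \<bind> (\<lambda>(u, m). return_spmf (u, l + m)))) \<and>
          finite (set_spmf (random_facet orient G (vtx p) \<bind> (\<lambda>(w, l).
            random_facet orient (face S) w \<bind> (\<lambda>(u, m). return_spmf (u, l + m))))) \<and>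
          fst ` set_spmf (random_facet orient G (vtx p) \<bind> (\<lambda>(w, l).
            random_facet orient (face S) w \<bind> (\<lambda>(u, m). return_spmf (u, l + m)))) \<subseteq> {vtx (sink S)}"
        unfolding i(2) case_prod_beta[of "\<lambda>w l. random_facet orient (face S) w \<bind> (\<lambda>(u, m). return_spmf (u, l + m))"]
        by (rule terminating_bind[OF _ inner[OF i(1)]]) (use step(1)[OF i(1)] in blast)+
    qed
  qed
qed

definition steps :: "nat set \<Rightarrow> nat \<times> nat \<Rightarrow> ennreal" where
  "steps S p = (\<integral>\<^sup>+ x. of_nat (snd x) \<partial>measure_spmf (random_facet orient (face S) (vtx p)))"

lemma steps_forced:
  assumes p: "p \<in> verts n" and S: "S \<subseteq> gale n p" and o: "outs n p - S = {i}"
  shows "steps S p = 1 + steps S (flip n p i)"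
proof -
  have ip: "i \<in> gale n p" "i \<notin> S" using outs_subset[OF p] o by blast+
  have q: "flip n p i \<in> verts n" "S \<subseteq> gale n (flip n p i)" using flip(1,2)[OF n_ge p ip(1)] ip S by auto
  have N: "out_nbrs orient (face S) (vtx p) = {vtx (flip n p i)}" unfolding out_nbrs_face[OF p S] o by simp
  have "steps S p = (\<integral>\<^sup>+ x. 1 + of_nat (snd x) \<partial>measure_spmf (random_facet orient (face S) (vtx (flip n p i))))"
    unfolding steps_def random_facet_forced[OF N] nn_integral_bind_spmf
    by (simp add: split_beta nn_integral_return_spmf)
  also have "\<dots> = 1 + steps S (flip n p i)"
    unfolding steps_def using random_facet_reaches_sink[OF q] by (intro nn_integral_lossless_add_const) blast
  finally show ?thesis .
qed

text \<open>A vertex has four labels, so each facet has probability \<open>1 / 4\<close>. As every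
  run in facet \<open>{i}\<close> ends in \<open>sink {i}\<close>, the continuation has a cost that
  does not depend on the outcome of the recursive call.\<close>

lemma steps_choose:
  assumes p: "p \<in> verts n" and o: "i \<in> outs n p" "j \<in> outs n p" "i \<noteq> j"
  shows "steps {} p = (\<Sum>i\<in>gale n p. steps {i} p + steps {} (sink {i})) / 4"
proof -
  have S: "{} \<subseteq> gale n p" by simp
  have ne: "out_nbrs orient (face {}) (vtx p) \<noteq> {}" using o out_nbrs_face[OF p S] by auto
  have "card (out_nbrs orient (face {}) (vtx p)) \<noteq> 1"
    using o unfolding card_out_nbrs_face[OF p S] by (auto simp: card_1_singleton_iff)
  note c = random_facet_choose[OF ne this]
  have inner: "(\<integral>\<^sup>+ y. of_nat (snd y) \<partial>measure_spmf (bind_spmf (random_facet orient (face {i}) (vtx p)) (\<lambda>(w, l).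
       bind_spmf (random_facet orient (face {}) w) (\<lambda>(u, m). return_spmf (u, l + m)))))
     = steps {i} p + steps {} (sink {i})" if i: "i \<in> gale n p" for i
  proof -
    have iS: "{i} \<subseteq> gale n p" using i by simp
    then have "{i} \<in> gale_complex n" using p by (auto simp: gale_complex_def)
    note s = sink[OF this]
    have l: "lossless_spmf (random_facet orient (face {}) (vtx (sink {i})))"
      using random_facet_reaches_sink[OF s(1), of "{}"] by simp
    note r = random_facet_reaches_sink[OF p iS]
    have "(\<integral>\<^sup>+ y. of_nat (snd y) \<partial>measure_spmf (bind_spmf (random_facet orient (face {i}) (vtx p)) (\<lambda>(w, l).
       bind_spmf (random_facet orient (face {}) w) (\<lambda>(u, m). return_spmf (u, l + m)))))
      = (\<integral>\<^sup>+ x. \<integral>\<^sup>+ y. of_nat (snd x) + of_nat (snd y) \<partial>measure_spmf (random_facet orient (face {}) (fst x))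
          \<partial>measure_spmf (random_facet orient (face {i}) (vtx p)))"
      unfolding nn_integral_bind_spmf by (simp add: split_beta nn_integral_return_spmf nn_integral_bind_spmf)
    also have "\<dots> = (\<integral>\<^sup>+ x. steps {} (sink {i}) + of_nat (snd x) \<partial>measure_spmf (random_facet orient (face {i}) (vtx p)))"
    proof (intro nn_integral_cong_AE, simp only: AE_measure_spmf_iff, intro ballI)
      fix x assume "x \<in> set_spmf (random_facet orient (face {i}) (vtx p))"
      then have x: "fst x = vtx (sink {i})" using r by blast
      show "(\<integral>\<^sup>+ y. of_nat (snd x) + of_nat (snd y) \<partial>measure_spmf (random_facet orient (face {}) (fst x)))
        = steps {} (sink {i}) + of_nat (snd x)"
        unfolding steps_def x nn_integral_lossless_add_const[OF l] by (rule add.commute)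
    qed
    also have "\<dots> = steps {} (sink {i}) + steps {i} p"
      unfolding steps_def[of "{i}" p] using r by (intro nn_integral_lossless_add_const) blast
    finally show ?thesis by (simp add: add.commute)
  qed
  have "steps {} p = (\<Sum>G\<in>(\<lambda>i. face {i}) ` gale n p. \<integral>\<^sup>+ y. of_nat (snd y) \<partial>measure_spmf (bind_spmf (random_facet orient G (vtx p)) (\<lambda>(w, l).
       bind_spmf (random_facet orient (face {}) w) (\<lambda>(u, m). return_spmf (u, l + m))))) / card ((\<lambda>i. face {i}) ` gale n p)"
    unfolding steps_def c nn_integral_bind_spmf[where p = "spmf_of_set _"] nn_integral_spmf_of_set
    using facets_through[OF p S] by simp
  also have "\<dots> = (\<Sum>i\<in>gale n p. steps {i} p + steps {} (sink {i})) / 4"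
    using inj_on_facets[OF p S] inner by (simp add: sum.reindex card_image card_gale[OF p])
  finally show ?thesis .
qed

text \<open>The Bochner integral of a non-integrable function is \<open>0\<close>, so a bound on
  \<open>steps\<close> carries over only after integrability is established from the finite
  support.\<close>

lemma expected_pivot_steps_ge:
  assumes p: "p \<in> verts n" and le: "ennreal c \<le> steps {} p"
  shows "c \<le> expected_pivot_steps orient P (vtx p)"
proof -
  let ?D = "random_facet orient P (vtx p)"
  have D: "?D = random_facet orient (face {}) (vtx p)" by (simp add: face_empty)
  have fin: "finite (set_spmf ?D)" using random_facet_reaches_sink[OF p, of "{}"] D by simp
  define B where "B = Max ((\<lambda>x. real (snd x)) ` set_spmf ?D)"
  have "integrable (measure_spmf ?D) (\<lambda>x. real (snd x))"
    by (rule measure_spmf.integrable_const_bound[where B = B]) (use fin in \<open>auto simp: B_def\<close>)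
  then have "ennreal (expected_pivot_steps orient P (vtx p)) = (\<integral>\<^sup>+ x. ennreal (real (snd x)) \<partial>measure_spmf ?D)"
    unfolding expected_pivot_steps_def by (subst nn_integral_eq_integral) auto
  also have "\<dots> = steps {} p" by (simp add: steps_def D ennreal_of_nat_eq_real_of_nat)
  finally have "ennreal c \<le> ennreal (expected_pivot_steps orient P (vtx p))" using le by simp
  moreover have "expected_pivot_steps orient P (vtx p) \<ge> 0" unfolding expected_pivot_steps_def by simp
  ultimately show ?thesis by (simp add: ennreal_le_iff)
qed

subsection \<open>The quadratic run\<close>

definition bottom_vertex :: "nat \<Rightarrow> nat \<times> nat" where
  "bottom_vertex j = (2 * j, 2 * j + 2)"

text \<open>One row below the top of the down-column: at the top itself, in row
  \<open>n - 2 - j\<close>, the right neighbour is not low and the only outgoing edge leads down, so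
  the first choice arises here.\<close>

definition top_vertex :: "nat \<Rightarrow> nat \<times> nat" where
  "top_vertex j = (2 * j + 1, n - 3 - j)"

lemma even_column:
  assumes "2 * j + 2 \<le> y" "y + j + 2 \<le> n"
  shows "(2 * j, y) \<in> verts n" "low n (2 * j, y)"
  using assms by (auto simp: verts_def low_def)

lemma odd_column:
  assumes "2 * j + 3 \<le> y" "y + j + 2 \<le> n"
  shows "(2 * j + 1, y) \<in> verts n" "low n (2 * j + 1, y)"
  using assms by (auto simp: verts_def low_def)

lemma outs_even_column:
  assumes "2 * j + 2 \<le> y" "y + j + 2 \<le> n" "3 * j + 5 \<le> n"
  shows "outs n (2 * j, y) = {2 * j} \<union> (if y + j + 3 \<le> n then {y} else {})"
proof -
  have "low n (nb1 n (2 * j, y))" using assms by (auto simp: low_def nb1_def)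
  then show ?thesis using even_column(2)[OF assms(1,2)] assms by (auto simp: outs_def low_def)
qed

lemma outs_odd_column:
  assumes "2 * j + 3 \<le> y" "y + j + 2 \<le> n" "3 * j + 7 \<le> n"
  shows "outs n (2 * j + 1, y) = (if y + j + 3 \<le> n then {2 * j + 1} else {}) \<union> (if y = 2 * j + 3 then {} else {Suc y})"
proof -
  have "low n (nb1 n (2 * j + 1, y)) \<longleftrightarrow> y + j + 3 \<le> n" using assms by (auto simp: low_def nb1_def)
  then show ?thesis using odd_column(2)[OF assms(1,2)] assms(1) by (auto simp: outs_def)
qed

lemma flip_column:
  assumes "x + 2 \<le> y" "Suc y < n"
  shows "flip n (x, y) y = (if x = 0 \<and> y + 2 = n then (1, n - 1) else (x, y + 1))" "flip n (x, y) x = nb1 n (x, y)"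
    "flip n (x, y) (Suc y) = nb4 n (x, y)"
  using assms by (auto simp: flip_def nb3_def)

text \<open>A vertex whose only outgoing label is \<open>i\<close> is the sink of facet
  \<open>{i}\<close>. At the top of an even column this label is the column itself, at the bottom of
  an odd column likewise (\<open>sink_odd\<close>), and at the top of an odd column it is the
  downward label, a row (\<open>sink_high\<close>).\<close>

lemma sink_even:
  assumes "3 * j + 5 \<le> n"
  shows "sink {2 * j} = (2 * j, n - 2 - j)"
  using assms even_column[of j "n - 2 - j"] outs_even_column[of j "n - 2 - j"]
  by (intro sink_eq) (auto simp: gale_def)

lemma sink_odd:
  assumes "3 * j + 7 \<le> n"
  shows "sink {2 * j + 1} = (2 * j + 1, 2 * j + 3)"
  using assms odd_column[of j "2 * j + 3"] outs_odd_column[of j "2 * j + 3"]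
  by (intro sink_eq) (auto simp: gale_def)

lemma sink_high:
  assumes "3 * j + 7 \<le> n"
  shows "sink {n - 1 - j} = (2 * j + 1, n - 2 - j)"
  using assms odd_column[of j "n - 2 - j"] outs_odd_column[of j "n - 2 - j"]
  by (intro sink_eq) (auto simp: gale_def)

lemma steps_forced_ge:
  assumes "p \<in> verts n" "outs n p = {i}" "flip n p i = q"
  shows "steps {} q \<le> steps {} p"
  using steps_forced[OF assms(1), of "{}" i] assms(2,3) by (simp add: add_increasing)

lemma steps_sink_high:
  assumes "3 * j + 8 \<le> n"
  shows "steps {} (top_vertex j) \<le> steps {} (sink {n - 1 - j})"
proof -
  have e: "outs n (2 * j + 1, n - 2 - j) = {Suc (n - 2 - j)}"
    using assms by (subst outs_odd_column) auto
  have j: "3 * j + 7 \<le> n" using assms by simp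
  show ?thesis unfolding sink_high[OF j]
  proof (rule steps_forced_ge[OF _ e])
    show "(2 * j + 1, n - 2 - j) \<in> verts n" using odd_column assms by auto
    show "flip n (2 * j + 1, n - 2 - j) (Suc (n - 2 - j)) = top_vertex j"
      using assms by (subst flip_column) (auto simp: nb4_def top_vertex_def)
  qed
qed

text \<open>Two forced steps: right to the top of the odd column, which is the sink of
  \<open>{n - 1 - j}\<close>, then down to the vertex with a choice.\<close>

lemma steps_sink_even:
  assumes "3 * j + 8 \<le> n"
  shows "steps {} (top_vertex j) \<le> steps {} (sink {2 * j})"
proof -
  have e: "outs n (2 * j, n - 2 - j) = {2 * j}"
    using assms by (subst outs_even_column) auto
  have j: "3 * j + 7 \<le> n" "3 * j + 5 \<le> n" using assms by auto
  have "steps {} (sink {n - 1 - j}) \<le> steps {} (sink {2 * j})"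
    unfolding sink_high[OF j(1)] sink_even[OF j(2)]
  proof (rule steps_forced_ge[OF _ e])
    show "(2 * j, n - 2 - j) \<in> verts n" using even_column assms by auto
    show "flip n (2 * j, n - 2 - j) (2 * j) = (2 * j + 1, n - 2 - j)"
      using assms by (subst flip_column) (auto simp: nb1_def)
  qed
  then show ?thesis using steps_sink_high[OF assms] by (rule order_trans[rotated])
qed

text \<open>On the diagonal the step to the right also goes one row up, so it reaches the bottom of
  the next up-column.\<close>

lemma steps_sink_odd:
  assumes "3 * j + 8 \<le> n"
  shows "steps {} (bottom_vertex (Suc j)) \<le> steps {} (sink {2 * j + 1})"
proof -
  have j: "3 * j + 7 \<le> n" using assms by simp
  have e: "outs n (2 * j + 1, 2 * j + 3) = {2 * j + 1}"
    using assms by (subst outs_odd_column) auto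
  show ?thesis unfolding sink_odd[OF j]
  proof (rule steps_forced_ge[OF _ e])
    show "(2 * j + 1, 2 * j + 3) \<in> verts n" using odd_column assms by auto
    show "flip n (2 * j + 1, 2 * j + 3) (2 * j + 1) = bottom_vertex (Suc j)"
      using assms by (subst flip_column) (auto simp: nb1_def bottom_vertex_def)
  qed
qed

lemma steps_up:
  assumes "3 * j + 5 \<le> n" "2 * j + 2 \<le> y" "y + j + 2 + m = n"
  shows "of_nat m \<le> steps {2 * j} (2 * j, y)"
  using assms(2,3)
proof (induction m arbitrary: y)
  case (Suc m)
  have o: "outs n (2 * j, y) - {2 * j} = {y}" using Suc.prems assms(1) by (subst outs_even_column) auto
  have "steps {2 * j} (2 * j, y) = 1 + steps {2 * j} (flip n (2 * j, y) y)"
    by (rule steps_forced[OF even_column(1) _ o]) (use Suc.prems in \<open>auto simp: gale_def\<close>)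
  moreover have "flip n (2 * j, y) y = (2 * j, y + 1)" using Suc.prems by (subst flip_column) auto
  moreover have "of_nat m \<le> steps {2 * j} (2 * j, y + 1)" using Suc.prems by (intro Suc.IH) auto
  ultimately show ?case by (simp add: add_left_mono)
qed simp

lemma steps_down:
  assumes "3 * j + 7 \<le> n" "y + j + 2 \<le> n" "y = 2 * j + 3 + m"
  shows "of_nat m \<le> steps {2 * j + 1} (2 * j + 1, y)"
  using assms(2,3)
proof (induction m arbitrary: y)
  case (Suc m)
  have o: "outs n (2 * j + 1, y) - {2 * j + 1} = {Suc y}" using Suc.prems assms(1) by (subst outs_odd_column) auto
  have "steps {2 * j + 1} (2 * j + 1, y) = 1 + steps {2 * j + 1} (flip n (2 * j + 1, y) (Suc y))"
    by (rule steps_forced[OF odd_column(1) _ o]) (use Suc.prems in \<open>auto simp: gale_def\<close>)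
  moreover have "flip n (2 * j + 1, y) (Suc y) = (2 * j + 1, y - 1)"
    using Suc.prems by (subst flip_column) (auto simp: nb4_def)
  moreover have "of_nat m \<le> steps {2 * j + 1} (2 * j + 1, y - 1)" using Suc.prems by (intro Suc.IH) auto
  ultimately show ?case by (simp add: add_left_mono)
qed simp

text \<open>The cost inside a facet is kept only for the facet \<open>l\<close> and dropped for the
  other three, while the continuations from all four sinks are kept.\<close>

lemma steps_choose_ge:
  assumes p: "p \<in> verts n" and o: "i \<in> outs n p" "j \<in> outs n p" "i \<noteq> j"
    and K: "l \<in> gale n p" "ennreal K \<le> steps {l} p" "0 \<le> K"
    and c: "\<And>i. i \<in> gale n p \<Longrightarrow> ennreal c \<le> steps {} (sink {i})" "0 \<le> c"
  shows "ennreal (c + K / 4) \<le> steps {} p"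
proof -
  have "ennreal K \<le> (\<Sum>i\<in>gale n p. steps {i} p)"
    using K(2) member_le_sum[OF K(1), of "\<lambda>i. steps {i} p"] by (auto intro: order_trans)
  moreover have "of_nat (card (gale n p)) * ennreal c \<le> (\<Sum>i\<in>gale n p. steps {} (sink {i}))"
    using c(1) by (rule sum_bounded_below)
  then have "ennreal (4 * c) \<le> (\<Sum>i\<in>gale n p. steps {} (sink {i}))"
    using c(2) by (simp add: card_gale[OF p] ennreal_mult)
  ultimately have "ennreal (K + 4 * c) \<le> (\<Sum>i\<in>gale n p. steps {i} p + steps {} (sink {i}))"
    using K(3) c(2) by (simp add: sum.distrib add_mono)
  then have "ennreal (K + 4 * c) / 4 \<le> steps {} p"
    unfolding steps_choose[OF p o] by (rule divide_right_mono_ennreal)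
  moreover have "ennreal (K + 4 * c) / 4 = ennreal ((K + 4 * c) / 4)"
    using K(3) c(2) divide_ennreal[of "K + 4 * c" 4] by simp
  ultimately show ?thesis by (simp add: add_divide_distrib add.commute)
qed

lemma steps_bottom_top_ge:
  assumes J: "3 * J + 8 \<le> n" and j: "j + 2 * d \<le> J"
  shows "ennreal (real d * (real n - 6 - 3 * real J) / 4) \<le> steps {} (bottom_vertex j) \<and>
    ennreal (real d * (real n - 6 - 3 * real J) / 4) \<le> steps {} (top_vertex j)"
  using j
proof (induction d arbitrary: j)
  case (Suc d)
  \<comment> \<open>A height available in all pairs of columns up to \<open>J\<close>: the up-column
    \<open>2 * j\<close> offers \<open>n - 4 - 3 * j\<close> steps and the down-column from
    \<open>top_vertex j\<close> offers \<open>n - 6 - 3 * j\<close>.\<close>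
  define K where "K = real n - 6 - 3 * real J"
  define c where "c = real d * K / 4"
  have K0: "K \<ge> 0" using J unfolding K_def by linarith
  have c0: "c \<ge> 0" using K0 by (simp add: c_def)
  have j: "j + 2 + 2 * d \<le> J" using Suc.prems by simp
  have IH: "ennreal c \<le> steps {} (bottom_vertex i) \<and> ennreal c \<le> steps {} (top_vertex i)" if "i \<le> j + 2" for i
    using Suc.IH[of i] that j unfolding c_def K_def by simp
  have n8: "3 * i + 8 \<le> n" if "i \<le> j + 2" for i using that j J by linarith
  have even: "ennreal c \<le> steps {} (sink {2 * i})" if "i \<le> j + 2" for i
    using IH[OF that] steps_sink_even[OF n8[OF that]] by (blast intro: order_trans)
  have odd: "ennreal c \<le> steps {} (sink {2 * i + 1})" if "i \<le> j + 1" for i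
    using IH[of "Suc i"] steps_sink_odd[of i] n8[of i] that by (auto intro: order_trans)
  have high: "ennreal c \<le> steps {} (sink {n - 1 - i})" if "i \<le> j + 2" for i
    using IH[OF that] steps_sink_high[OF n8[OF that]] by (blast intro: order_trans)
  have n: "3 * j + 14 \<le> n" using n8[of "j + 2"] by simp
  have "ennreal (c + K / 4) \<le> steps {} (bottom_vertex j)"
  proof (rule steps_choose_ge[where l = "2 * j" and i = "2 * j" and j = "2 * j + 2"])
    show v: "bottom_vertex j \<in> verts n" unfolding bottom_vertex_def using n by (intro even_column) auto
    show "2 * j \<in> outs n (bottom_vertex j)" "2 * j + 2 \<in> outs n (bottom_vertex j)"
      unfolding bottom_vertex_def using n by (subst outs_even_column; force)+
    show "2 * j \<in> gale n (bottom_vertex j)" by (simp add: bottom_vertex_def gale_def)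
    have "ennreal K \<le> of_nat (n - 4 - 3 * j)"
      using n j J unfolding K_def by (simp add: ennreal_of_nat_eq_real_of_nat of_nat_diff)
    also have "\<dots> \<le> steps {2 * j} (bottom_vertex j)"
      unfolding bottom_vertex_def using n by (intro steps_up) auto
    finally show "ennreal K \<le> steps {2 * j} (bottom_vertex j)" .
    fix i assume "i \<in> gale n (bottom_vertex j)"
    \<comment> \<open>Label \<open>2 * (j + 1) + 1\<close> leads furthest, to
      \<open>bottom_vertex (j + 2)\<close>. This is why \<open>d\<close> counts pairs of columns in
      twos.\<close>
    then consider "i = 2 * j" | "i = 2 * j + 1" | "i = 2 * (j + 1)" | "i = 2 * (j + 1) + 1"
      using n by (auto simp: bottom_vertex_def gale_def split: if_splits)
    then show "ennreal c \<le> steps {} (sink {i})"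
      by cases (simp only:; intro even odd; simp)+
  qed (use K0 c0 in auto)
  moreover have "ennreal (c + K / 4) \<le> steps {} (top_vertex j)"
  proof (rule steps_choose_ge[where l = "2 * j + 1" and i = "2 * j + 1" and j = "Suc (n - 3 - j)"])
    show v: "top_vertex j \<in> verts n" unfolding top_vertex_def using n by (intro odd_column) auto
    have "outs n (top_vertex j) = {2 * j + 1, Suc (n - 3 - j)}"
      unfolding top_vertex_def using n by (subst outs_odd_column) auto
    then show "2 * j + 1 \<in> outs n (top_vertex j)" "Suc (n - 3 - j) \<in> outs n (top_vertex j)" by simp_all
    show "2 * j + 1 \<noteq> Suc (n - 3 - j)" using n by simp
    show "2 * j + 1 \<in> gale n (top_vertex j)" by (simp add: top_vertex_def gale_def)
    have "ennreal K \<le> of_nat (n - 6 - 3 * j)"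
      using n j J unfolding K_def by (simp add: ennreal_of_nat_eq_real_of_nat of_nat_diff)
    also have "\<dots> \<le> steps {2 * j + 1} (top_vertex j)"
      unfolding top_vertex_def using n by (intro steps_down) auto
    finally show "ennreal K \<le> steps {2 * j + 1} (top_vertex j)" .
    fix i assume "i \<in> gale n (top_vertex j)"
    \<comment> \<open>The row labels \<open>n - 3 - j\<close> and \<open>n - 2 - j\<close> have
      their sinks in the pairs \<open>j + 2\<close> and \<open>j + 1\<close>, by the slope of the
      line.\<close>
    then consider "i = 2 * j + 1" | "i = 2 * (j + 1)" | "i = n - 1 - (j + 2)" | "i = n - 1 - (j + 1)"
      using n by (auto simp: top_vertex_def gale_def split: if_splits)
    then show "ennreal c \<le> steps {} (sink {i})"
      by cases (simp only:; intro even odd high; simp)+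
  qed (use K0 c0 in auto)
  moreover have "c + K / 4 = real (Suc d) * K / 4" by (simp add: c_def field_simps)
  ultimately show ?case unfolding K_def by simp
qed simp

lemma steps_source_ge:
  assumes J: "3 * J + 8 \<le> n" and d: "2 + 2 * d \<le> J"
  shows "ennreal (real d * (real n - 6 - 3 * real J) / 4) \<le> steps {} source"
proof -
  define c where "c = real d * (real n - 6 - 3 * real J) / 4"
  have c0: "c \<ge> 0" using J unfolding c_def by simp
  have top: "ennreal c \<le> steps {} (top_vertex i)" "3 * i + 8 \<le> n" if "i \<le> 2" for i
    using steps_bottom_top_ge[OF J, of i d] d J that unfolding c_def by auto
  have high: "ennreal c \<le> steps {} (sink {n - 1 - i})" if "i \<le> 2" for i
    using top[OF that] steps_sink_high[of i] by (blast intro: order_trans)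
  have zero: "ennreal c \<le> steps {} (sink {2 * 0})"
    using top[of 0] steps_sink_even[of 0] by (auto intro: order_trans)
  \<comment> \<open>At the source no forced column is charged. Its labels \<open>n - 3\<close>,
    \<open>n - 2\<close>, \<open>n - 1\<close> and \<open>0\<close> send the run to the top vertices
    of the pairs 2, 1, 0 and 0.\<close>
  have "ennreal (c + 0 / 4) \<le> steps {} source"
  proof (rule steps_choose_ge[OF source_verts, where l = 0 and i = "n - 3" and j = "n - 1"])
    show "n - 3 \<in> outs n source" "n - 1 \<in> outs n source" "n - 3 \<noteq> n - 1" "0 \<in> gale n source"
      unfolding outs_source using n_ge by (auto simp: source_def gale_def)
    fix i assume "i \<in> gale n source"
    then consider "i = n - 1 - 2" | "i = n - 1 - 1" | "i = n - 1 - 0" | "i = 2 * 0"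
      using n_ge by (auto simp: source_def gale_def split: if_splits)
    then show "ennreal c \<le> steps {} (sink {i})"
      by cases (simp only:; intro high zero; simp)+
  qed (use c0 in auto)
  then show ?thesis by (simp add: c_def)
qed

end

theorem theorem4p1:
  shows "\<exists>c>0::real. \<exists>K::nat. \<forall>k\<ge>K. \<forall>n. n = 12 * k + 1 \<longrightarrow>
    (\<forall>P. is_dual_cyclic4 n P \<longrightarrow>
      (\<exists>A s. AUSO P A \<and> global_source P A s \<and>
        expected_pivot_steps A P s \<ge> c * (real n)\<^sup>2))"
proof (intro exI[of _ "1/500 :: real"] conjI exI[of _ "2 :: nat"] allI impI)
  fix k n :: nat and P :: "(real ^ 4) set"
  assume k: "2 \<le> k" and n: "n = 12 * k + 1" and P: "is_dual_cyclic4 n P"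
  interpret dual_cyclic n P by unfold_locales (use k n P in auto)
  \<comment> \<open>With \<open>J = 2 * k\<close> the columns keep a height of at least
    \<open>6 * k - 5\<close>, and \<open>k - 1\<close> is the largest \<open>d\<close> with
    \<open>2 + 2 * d \<le> J\<close>.\<close>
  have "ennreal (real (k - 1) * (real n - 6 - 3 * real (2 * k)) / 4) \<le> steps {} source"
    by (rule steps_source_ge) (use k n in auto)
  then have ge: "real (k - 1) * (real n - 6 - 3 * real (2 * k)) / 4 \<le> expected_pivot_steps orient P (vtx source)"
    by (rule expected_pivot_steps_ge[OF source_verts])
  \<comment> \<open>For \<open>k\<close> at least 2, \<open>k - 1\<close> is at least
    \<open>k / 2\<close> and \<open>6 * k - 5\<close> at least \<open>3 * k\<close>, so the cost is
    at least \<open>3 / 8\<close> times the square of \<open>k\<close>. As \<open>n\<close> is at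
    most \<open>13 * k\<close> and \<open>169 / 500\<close> is below \<open>3 / 8\<close>, the
    constant \<open>1 / 500\<close> works.\<close>
  have "(real k / 2) * (3 * real k) \<le> real (k - 1) * (real n - 6 - 3 * real (2 * k))"
    using k n by (intro mult_mono) (auto simp: of_nat_diff)
  moreover have "(real n)\<^sup>2 \<le> (13 * real k)\<^sup>2" using k n by (intro power_mono) auto
  ultimately have "1 / 500 * (real n)\<^sup>2 \<le> expected_pivot_steps orient P (vtx source)"
    using ge zero_le_square[of "real k"] unfolding power2_eq_square by linarith
  then show "\<exists>A s. AUSO P A \<and> global_source P A s \<and> 1 / 500 * (real n)\<^sup>2 \<le> expected_pivot_steps A P s"
    using AUSO_orient global_source_source by blast
qed simp

end
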